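(* Let $T$ be any triangulation of the pinched torus, and let $n_0^T, n_1^T, n_2^T$ be respectively the numbers of vertices, edges and triangles of $T$. Then $$n_0^T - n_1^T + n_2^T = 1.$$
   Context: The pinched torus is the (singular) surface in $\mathbb{R}^3$ defined by the parameterization $$x = \left( r_1 + r_2 \cos(v) \cos\left(\tfrac{1}{2} u\right) \right) \cos(u),\quad y = \left( r_1 + r_2 \cos(v) \cos\left(\tfrac{1}{2} u\right) \right) \sin(u),\quad z = r_2 \sin(v) \cos\left(\tfrac{1}{2} u\right),$$ with $u, v \in [0, 2\pi]$, where $r_1$ and $r_2$ are respectively the large and small radii ($r_1 > r_2 > 0$). It has a single singular point, attained at $u = \pi$. A triangulation of such a compact (possibly singular) surface is a finite two-dimensional simplicial complex together with a homeomorphism from its geometric realization onto the surface. *)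

theory Defs
  imports "HOL-Analysis.Analysis"
begin

definition pinched_torus :: "real \<Rightarrow> real \<Rightarrow> (real ^ 3) set" where
  "pinched_torus r1 r2 =
     {vector [(r1 + r2 * cos v * cos (u / 2)) * cos u,
              (r1 + r2 * cos v * cos (u / 2)) * sin u,
              r2 * sin v * cos (u / 2)] | u v. u \<in> {0..2 * pi} \<and> v \<in> {0..2 * pi}}"

text \<open>
  A complex is a finite family of simplices in some Euclidean space, so its geometric realization
  is its union; every finite abstract complex is realized in this way.  The library's
  \<^const>\<open>simplicial_complex\<close> admits the empty set as a simplex of dimension \<open>-1\<close>, which is why
  simplices are always counted by dimension below.
\<close>

definition two_dimensional :: "'a::euclidean_space set set \<Rightarrow> bool" where
  "two_dimensional K \<longleftrightarrow> (\<forall>S\<in>K. aff_dim S \<le> 2) \<and> (\<exists>S\<in>K. aff_dim S = 2)"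

definition surface_triangulation ::
    "'a::euclidean_space set set \<Rightarrow> ('a \<Rightarrow> 'b::topological_space) \<Rightarrow> 'b set \<Rightarrow> bool" where
  "surface_triangulation K h X \<longleftrightarrow>
     simplicial_complex K \<and> two_dimensional K \<and> (\<exists>k. homeomorphism (\<Union>K) X h k)"

definition num_simplices :: "int \<Rightarrow> 'a::euclidean_space set set \<Rightarrow> nat" where
  "num_simplices d K = card {S \<in> K. d simplex S}"

end

theory Submission
  imports Defs
begin

text \<open>
  The pinched torus is the sphere with two points glued together.  Pulling the 1-skeleton back to
  the sphere gives a connected graph with \<open>n0 + 1\<close> vertices (the pinch point is necessarily a vertex
  and is split in two), \<open>n1\<close> arcs and \<open>n2\<close> faces.  A spanning tree of this graph does not separate
  the sphere (Janiszewski), so the faces are joined to each other across the arcs outside the tree,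
  and \<open>n2 - 1\<close> of these arcs already suffice, since by invariance of domain an arc lies on at most two
  faces.  Any further arc would close a Jordan curve with the tree, all faces would lie on one side of
  it, and yet the faces are dense.  Hence \<open>n1 = n0 + (n2 - 1)\<close>.
\<close>

text \<open>A homeomorphism from the realization remembers nothing combinatorial: edges become
  arbitrary arcs, and purity of the complex, the bound of two triangles per edge, the pinch being a
  vertex and the connectedness of the graph all have to be won from planar topology. Puncturing the
  sphere at a point inside a triangle moves the question into the complex plane; the puncture misses
  every vertex and edge, and the one open triangle that loses a point stays connected. The gluing is
  the other obstacle. The image of a point does not tell the two poles apart, so for each edge or
  triangle at the pinch point one has to decide which pole it approaches. Convexity decides: a
  simplex without one of its vertices is convex, hence connected near the pinch, whereas a punctured
  neighbourhood of the pinch falls into two pieces, one for each pole.\<close>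

lemma spanning_tree_induct:
  fixes N :: "'e \<Rightarrow> 'v set"
  assumes "finite X" "x \<in> X"
    and cross: "\<And>S. \<lbrakk>S \<subseteq> X; S \<noteq> {}; S \<noteq> X\<rbrakk> \<Longrightarrow> \<exists>e\<in>E. \<exists>u\<in>S. \<exists>v\<in>X - S. N e = {u, v}"
    and base: "P {x} {}"
    and step: "\<And>S D e u v. \<lbrakk>P S D; S \<subseteq> X; D \<subseteq> E; \<And>d. d \<in> D \<Longrightarrow> N d \<subseteq> S; e \<in> E - D;
                 N e = {u, v}; u \<in> S; v \<in> X - S\<rbrakk> \<Longrightarrow> P (insert v S) (insert e D)"
  obtains D where "finite D" "D \<subseteq> E" "card D + 1 = card X" "P X D" "\<And>d. d \<in> D \<Longrightarrow> N d \<subseteq> X"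
proof -
  \<comment> \<open>The conjunct on \<open>N\<close> makes each added edge new, since its end
    \<open>v\<close> lies outside \<open>S\<close>; so \<open>card D\<close> stays exactly one below
    \<open>card S\<close>. The rule serves both the vertex graph and the dual graph of
    triangles.\<close>
  have "\<exists>S D. S \<subseteq> X \<and> S \<noteq> {} \<and> card S = Suc n \<and> finite D \<and> D \<subseteq> E \<and> card D = n
          \<and> (\<forall>d\<in>D. N d \<subseteq> S) \<and> P S D" if "n < card X" for n
    using that
  proof (induction n)
    case 0
    show ?case
      by (intro exI [of _ "{x}"] exI [of _ "{}"]) (use \<open>x \<in> X\<close> base in simp)
  next
    case (Suc n)
    from Suc.IH [OF Suc_lessD [OF Suc.prems]]
    obtain S D where SD: "S \<subseteq> X" "S \<noteq> {}" "card S = Suc n" "finite D" "D \<subseteq> E" "card D = n"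
      "\<forall>d\<in>D. N d \<subseteq> S" "P S D"
      by (elim exE conjE)
    then have "S \<noteq> X"
      using Suc.prems by auto
    then obtain e u v where e: "e \<in> E" "u \<in> S" "v \<in> X - S" "N e = {u, v}"
      using cross [OF SD(1,2)] by blast
    then have "e \<notin> D"
      using SD(7) by auto
    have "finite S"
      using SD \<open>finite X\<close> finite_subset by blast
    show ?case
    proof (intro exI conjI)
      show "P (insert v S) (insert e D)"
        by (rule step [of S D e u v]) (use SD(1-7) e \<open>e \<notin> D\<close> in \<open>auto intro: SD(8)\<close>)
    qed (use SD(1-7) e \<open>e \<notin> D\<close> \<open>finite S\<close> in auto)
  qed
  moreover have "card X > 0"
    using \<open>finite X\<close> \<open>x \<in> X\<close> by (auto simp: card_gt_0_iff)
  ultimately obtain S D where SD: "S \<subseteq> X" "S \<noteq> {}" "card S = Suc (card X - 1)"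
    "finite D" "D \<subseteq> E" "card D = card X - 1" "\<forall>d\<in>D. N d \<subseteq> S" "P S D"
    by (metis diff_less zero_less_one)
  then have "S = X"
    using \<open>finite X\<close> \<open>card X > 0\<close> by (simp add: card_subset_eq)
  then show ?thesis
    using that [of D] SD \<open>card X > 0\<close> by simp
qed

section \<open>Simplices and simplicial complexes\<close>

lemma affine_independent_3_coords:
  fixes a b c :: "'a::euclidean_space"
  assumes "\<not> affine_dependent {a, b, c}" "a \<noteq> b" "a \<noteq> c" "b \<noteq> c"
    and "x *\<^sub>R (b - a) + y *\<^sub>R (c - a) = 0"
  shows "x = 0 \<and> y = 0"
proof (rule ccontr)
  assume neg: "\<not> ?thesis"
  define u where "u = (\<lambda>z. if z = a then - (x + y) else if z = b then x else y)"
  have "affine_dependent {a, b, c}"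
    unfolding affine_dependent_explicit_finite [OF finite.insertI [OF finite.insertI [OF finite.insertI [OF finite.emptyI]]]]
  proof (intro exI conjI)
    show "sum u {a, b, c} = 0"
      using assms by (simp add: u_def)
    show "\<exists>v\<in>{a, b, c}. u v \<noteq> 0"
      using assms neg by (auto simp: u_def)
    show "(\<Sum>v\<in>{a, b, c}. u v *\<^sub>R v) = 0"
      using assms by (simp add: u_def algebra_simps)
  qed
  with assms show False
    by blast
qed

lemma rel_interior_triangle_mem:
  fixes a b c :: "'a::euclidean_space"
  assumes "\<not> affine_dependent {a, b, c}" "a \<noteq> b" "a \<noteq> c" "b \<noteq> c"
    and "0 < x" "0 < y" "x + y < 1"
  shows "a + x *\<^sub>R (b - a) + y *\<^sub>R (c - a) \<in> rel_interior (convex hull {a, b, c})"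
proof -
  define u where "u = (\<lambda>z. if z = a then 1 - (x + y) else if z = b then x else y)"
  show ?thesis
    unfolding rel_interior_convex_hull_explicit [OF assms(1)]
    by (rule CollectI, rule exI [of _ u]) (use assms in \<open>auto simp: u_def algebra_simps\<close>)
qed

lemma simplexE_1:
  assumes "1 simplex S"
  obtains a b where "a \<noteq> b" "S = closed_segment a b"
proof -
  obtain C where "card C = 2" "S = convex hull C"
    using assms by (auto simp: simplex_def)
  then show ?thesis
    using that by (metis card_2_iff segment_convex_hull)
qed

locale simplicial_cpx =
  fixes K :: "'a::euclidean_space set set"
  assumes complex: "simplicial_complex K"
begin

lemma finite_complex: "finite K"
  and complex_simplex: "S \<in> K \<Longrightarrow> \<exists>n. n simplex S"
  and complex_face: "\<lbrakk>S \<in> K; F face_of S\<rbrakk> \<Longrightarrow> F \<in> K"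
  and complex_Int: "\<lbrakk>S \<in> K; S' \<in> K\<rbrakk> \<Longrightarrow> S \<inter> S' face_of S"
  using complex by (auto simp: simplicial_complex_def)

lemma complex_Int_mem: "\<lbrakk>S \<in> K; S' \<in> K\<rbrakk> \<Longrightarrow> S \<inter> S' \<in> K"
  using complex_face complex_Int by blast

lemma complex_convex: "S \<in> K \<Longrightarrow> convex S"
  and complex_closed: "S \<in> K \<Longrightarrow> closed S"
  and complex_polyhedron: "S \<in> K \<Longrightarrow> polyhedron S"
  using complex_simplex convex_simplex closed_simplex simplex_imp_polyhedron by blast+

lemma complex_simplex_iff: "S \<in> K \<Longrightarrow> n simplex S \<longleftrightarrow> aff_dim S = n"
  using complex_simplex aff_dim_simplex by blast

lemma closure_rel_interior_complex: "S \<in> K \<Longrightarrow> closure (rel_interior S) = S"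
  by (simp add: complex_closed complex_convex convex_closure_rel_interior)

lemma closed_Union_subcomplex: "C \<subseteq> K \<Longrightarrow> closed (\<Union>C)"
  using complex_closed finite_complex finite_subset by (metis closed_Union subsetD)

text \<open>The intersection is a face of \<open>S\<close>, and a face that meets the relative
  interior is all of \<open>S\<close>.\<close>

lemma rel_interior_meets_imp_subset:
  assumes "S \<in> K" "S' \<in> K" "x \<in> rel_interior S" "x \<in> S'"
  shows "S \<subseteq> S'"
proof -
  have "S \<subseteq> S \<inter> S'"
    by (rule subset_of_face_of [OF complex_Int]) (use assms rel_interior_subset in auto)
  then show ?thesis
    by blast
qed

lemma rel_interior_inj:
  "\<lbrakk>S \<in> K; S' \<in> K; x \<in> rel_interior S; x \<in> rel_interior S'\<rbrakk> \<Longrightarrow> S = S'"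
  by (meson rel_interior_meets_imp_subset rel_interior_subset subset_antisym subsetD)

text \<open>A simplex minimal among those through \<open>x\<close> works: on its relative frontier
  \<open>x\<close> would lie in a proper face, which is again in \<open>K\<close>.\<close>

lemma carrier_simplex:
  assumes "x \<in> \<Union>K"
  obtains S where "S \<in> K" "x \<in> rel_interior S"
proof -
  have "finite {S \<in> K. x \<in> S}" "{S \<in> K. x \<in> S} \<noteq> {}"
    using finite_complex assms by auto
  then obtain S where S: "S \<in> K" "x \<in> S" and min: "\<And>F. \<lbrakk>F \<in> K; x \<in> F; F \<subseteq> S\<rbrakk> \<Longrightarrow> F = S"
    using finite_has_minimal [of "{S \<in> K. x \<in> S}"] by auto
  have "x \<in> rel_interior S"
  proof (rule ccontr)
    assume "x \<notin> rel_interior S"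
    then have "x \<in> rel_frontier S"
      using S closure_subset by (auto simp: rel_frontier_def)
    then obtain F where "F face_of S" "F \<noteq> S" "x \<in> F"
      using rel_frontier_of_polyhedron_alt [OF complex_polyhedron [OF S(1)]] by auto
    then show False
      using min S complex_face face_of_imp_subset by blast
  qed
  then show ?thesis
    using that S by blast
qed

text \<open>Within the realization, the complement of the open star is the union of the simplices
  that do not contain \<open>S\<close>, a finite union of closed sets.\<close>

lemma openin_open_star:
  assumes "S \<in> K"
  shows "openin (top_of_set (\<Union>K)) (\<Union>S'\<in>{S' \<in> K. S \<subseteq> S'}. rel_interior S')" (is "openin _ ?W")
proof -
  have "?W = \<Union>K - \<Union>{S' \<in> K. \<not> S \<subseteq> S'}"
  proof (intro equalityI subsetI)
    fix x assume "x \<in> ?W"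
    then show "x \<in> \<Union>K - \<Union>{S' \<in> K. \<not> S \<subseteq> S'}"
      using rel_interior_meets_imp_subset rel_interior_subset by fastforce
  next
    fix x assume x: "x \<in> \<Union>K - \<Union>{S' \<in> K. \<not> S \<subseteq> S'}"
    then obtain S' where "S' \<in> K" "x \<in> rel_interior S'"
      by (meson DiffD1 carrier_simplex)
    then show "x \<in> ?W"
      using x rel_interior_subset by fastforce
  qed
  moreover have "closed (\<Union>{S' \<in> K. \<not> S \<subseteq> S'})"
    by (rule closed_Union_subcomplex) auto
  ultimately show ?thesis
    by (metis Diff_eq open_Compl openin_open_Int)
qed

lemma near_point_simplices:
  obtains d where "d > 0" "\<And>S. \<lbrakk>S \<in> K; S \<inter> ball x d \<noteq> {}\<rbrakk> \<Longrightarrow> x \<in> S"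
proof -
  have "open (- \<Union>{S \<in> K. x \<notin> S})"
    by (intro open_Compl closed_Union_subcomplex) auto
  moreover have "x \<in> - \<Union>{S \<in> K. x \<notin> S}"
    by auto
  ultimately obtain d where "d > 0" "ball x d \<subseteq> - \<Union>{S \<in> K. x \<notin> S}"
    by (meson open_contains_ball)
  then show ?thesis
    using that [of d] by blast
qed

lemma vertex_mem:
  assumes "S \<in> K" "S = convex hull C" "\<not> affine_dependent C" "a \<in> S" "{a} \<in> K"
  shows "a \<in> C"
proof -
  have "{a} face_of S"
    using complex_Int [of S "{a}"] assms by (simp add: Int_absorb1)
  then obtain B where "B \<subseteq> C" "{a} = convex hull B"
    using assms face_of_convex_hull_affine_independent by blast
  then show ?thesis
    by (metis convex_hull_eq_empty ex_in_conv hull_inc insert_not_empty singletonD subsetD)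
qed

lemma subface_mem:
  assumes "S \<in> K" "S = convex hull C" "\<not> affine_dependent C" "B \<subseteq> C"
  shows "convex hull B \<in> K"
  by (metis assms complex_face face_of_convex_hull_affine_independent)

lemma edge_mem:
  assumes "S \<in> K" "{a} \<in> K" "{b} \<in> K" "a \<in> S" "b \<in> S"
  shows "closed_segment a b \<in> K"
proof -
  obtain C where C: "\<not> affine_dependent C" "S = convex hull C"
    using complex_simplex [OF assms(1)] by (auto simp: simplex_def)
  then have "{a, b} \<subseteq> C"
    using vertex_mem assms by blast
  then show ?thesis
    using subface_mem [OF assms(1)] C by (simp add: segment_convex_hull)
qed

lemma vertex_neq:
  assumes "S \<in> K" "x \<in> S" "x \<noteq> q"
  obtains a where "a \<in> S" "{a} \<in> K" "a \<noteq> q"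
proof -
  obtain C where C: "\<not> affine_dependent C" "S = convex hull C"
    using complex_simplex [OF assms(1)] by (auto simp: simplex_def)
  have "\<not> C \<subseteq> {q}"
    using assms C by (metis convex_hull_singleton hull_mono subset_singletonD singletonD subsetD)
  then obtain a where "a \<in> C" "a \<noteq> q"
    by blast
  then show ?thesis
    using that [of a] subface_mem [OF assms(1) C(2,1), of "{a}"] C by (simp add: hull_inc)
qed

lemma triangle_over_edge:
  assumes "t \<in> K" "aff_dim t = 2" "closed_segment a b \<in> K" "a \<noteq> b" "closed_segment a b \<subseteq> t"
  obtains c where "t = convex hull {a, b, c}" "\<not> affine_dependent {a, b, c}" "c \<noteq> a" "c \<noteq> b"
proof -
  have "2 simplex t"
    using assms complex_simplex_iff by auto
  then obtain C where C: "\<not> affine_dependent C" "t = convex hull C" "card C = 3"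
    by (auto simp: simplex_def)
  have "{a} \<in> K" "{b} \<in> K"
    using assms(3) subface_mem [of "closed_segment a b" "{a, b}" "{a}"]
      subface_mem [of "closed_segment a b" "{a, b}" "{b}"] by (auto simp: segment_convex_hull)
  then have ab: "a \<in> C" "b \<in> C"
    using vertex_mem [OF assms(1) C(2,1)] assms(5) by auto
  have "finite C"
    using C aff_independent_finite by blast
  then have "card (C - {a, b}) = 1"
    using C(3) ab \<open>a \<noteq> b\<close> by (simp add: card_Diff_subset)
  then obtain c where "C - {a, b} = {c}"
    using card_1_singletonE by blast
  then have "C = {a, b, c}" "c \<noteq> a" "c \<noteq> b"
    using ab by auto
  then show ?thesis
    using that C by auto
qed

end

section \<open>Triangulated spheres with two points identified\<close>

lemma connected_openin_cases:
  assumes "connected N" "N \<subseteq> X" "openin (top_of_set X) A" "openin (top_of_set X) B"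
    and "A \<inter> B = {}" "N \<subseteq> A \<union> B"
  shows "N \<subseteq> A \<or> N \<subseteq> B"
proof -
  obtain A' B' where AB: "open A'" "A = X \<inter> A'" "open B'" "B = X \<inter> B'"
    using assms by (meson openin_open)
  then have "A' \<inter> B' \<inter> N = {}" "N \<subseteq> A' \<union> B'"
    using assms by auto
  then have "A' \<inter> N = {} \<or> B' \<inter> N = {}"
    using connectedD [OF assms(1) AB(1,3)] by blast
  then show ?thesis
    using assms AB by auto
qed

text \<open>
  The map \<open>g\<close> is the quotient map from the sphere onto the realization, which glues \<open>\<alpha>\<close> to \<open>\<beta>\<close>,
  read in the stereographic chart centred at the preimage of a point \<open>x0\<close> interior to a triangle.
\<close>

locale pinched_cpx = simplicial_cpx K for K :: "'a::euclidean_space set set" +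
  fixes g :: "complex \<Rightarrow> 'a" and \<alpha> \<beta> :: complex and q x0 :: 'a and t0 :: "'a set"
  assumes dim_le: "S \<in> K \<Longrightarrow> aff_dim S \<le> 2"
    and t0: "t0 \<in> K" "aff_dim t0 = 2" "x0 \<in> rel_interior t0"
    and cont: "continuous_on UNIV g"
    and poles: "\<alpha> \<noteq> \<beta>" "g \<alpha> = q" "g \<beta> = q"
    and g_eqD: "g z = g w \<Longrightarrow> z = w \<or> z \<in> {\<alpha>, \<beta>} \<and> w \<in> {\<alpha>, \<beta>}"
    and range_g: "range g = \<Union>K - {x0}"
    and open_sat: "\<lbrakk>open Y; \<alpha> \<in> Y \<longleftrightarrow> \<beta> \<in> Y\<rbrakk> \<Longrightarrow> openin (top_of_set (\<Union>K)) (g ` Y)"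
begin

section \<open>The chart and its partial inverse\<close>

definition "faces = {t \<in> K. aff_dim t = 2}"
definition "edges = {e \<in> K. aff_dim e = 1}"
definition "verts = {v. {v} \<in> K}"

text \<open>Inverts \<open>g\<close> on the realization without \<open>q\<close> and
  \<open>x0\<close>; at those two points the value is arbitrary and must never be used.\<close>

definition "\<psi> = inv_into (- {\<alpha>, \<beta>}) g"

lemma g_eq_q_iff: "g z = q \<longleftrightarrow> z \<in> {\<alpha>, \<beta>}"
  using g_eqD poles by (metis insertCI insertE singletonD)

lemma inj_on_g: "inj_on g (- {\<alpha>, \<beta>})"
  using g_eqD by (auto simp: inj_on_def)

lemma g_mem: "g z \<in> \<Union>K" "g z \<noteq> x0"
  using range_g by blast+

lemma g_psi: "\<lbrakk>x \<in> \<Union>K; x \<noteq> q; x \<noteq> x0\<rbrakk> \<Longrightarrow> g (\<psi> x) = x"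
  and psi_nonpole: "\<lbrakk>x \<in> \<Union>K; x \<noteq> q; x \<noteq> x0\<rbrakk> \<Longrightarrow> \<psi> x \<notin> {\<alpha>, \<beta>}"
proof -
  assume x: "x \<in> \<Union>K" "x \<noteq> q" "x \<noteq> x0"
  then obtain z where "x = g z"
    using range_g by blast
  then have "x \<in> g ` (- {\<alpha>, \<beta>})"
    using x g_eq_q_iff by blast
  then have "g (\<psi> x) = x \<and> \<psi> x \<in> - {\<alpha>, \<beta>}"
    unfolding \<psi>_def by (simp only: inv_into_into f_inv_into_f simp_thms)
  then show "g (\<psi> x) = x" "\<psi> x \<notin> {\<alpha>, \<beta>}"
    by simp_all
qed

lemma psi_g: "z \<notin> {\<alpha>, \<beta>} \<Longrightarrow> \<psi> (g z) = z"
  by (simp add: \<psi>_def inj_on_g)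

text \<open>\<open>open_sat\<close> expresses the quotient topology: an open set that treats both
  poles alike has open image. Deleting the poles from an open \<open>B\<close> makes it such a set,
  and its image is the preimage of \<open>B\<close> under \<open>\<psi>\<close>.\<close>

lemma continuous_on_psi: "continuous_on (\<Union>K - {q, x0}) \<psi>"
proof -
  have "openin (top_of_set (\<Union>K - {q, x0})) ((\<Union>K - {q, x0}) \<inter> \<psi> -` B)" if "open B" for B
  proof -
    have "(\<Union>K - {q, x0}) \<inter> \<psi> -` B = g ` (B - {\<alpha>, \<beta>})" (is "?l = ?r")
    proof
      show "?l \<subseteq> ?r"
      proof
        fix x assume "x \<in> ?l"
        then have "x = g (\<psi> x)" "\<psi> x \<in> B - {\<alpha>, \<beta>}"
          using g_psi psi_nonpole by auto
        then show "x \<in> ?r"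
          by blast
      qed
      show "?r \<subseteq> ?l"
        using psi_g g_mem g_eq_q_iff by auto
    qed
    moreover have "openin (top_of_set (\<Union>K)) (g ` (B - {\<alpha>, \<beta>}))"
      by (rule open_sat) (use that in \<open>auto simp: open_Diff\<close>)
    ultimately show ?thesis
      by (metis Diff_subset Int_lower1 openin_subset_trans)
  qed
  then show ?thesis
    by (simp add: continuous_openin_preimage_eq)
qed

section \<open>Purity of the complex and density of the triangles\<close>

lemma open_vimage_openin:
  assumes "openin (top_of_set (\<Union>K)) W"
  shows "open (g -` W)"
proof -
  obtain W' where "open W'" "W = \<Union>K \<inter> W'"
    using assms by (meson openin_open)
  moreover have "g -` (\<Union>K \<inter> W') = g -` W'"
    using g_mem by blast
  ultimately show ?thesis
    using cont open_vimage by metis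
qed

lemma open_minus_poles_nonempty:
  assumes "open Y" "Y \<noteq> {}"
  shows "Y - {\<alpha>, \<beta>} \<noteq> {}"
proof
  assume "Y - {\<alpha>, \<beta>} = {}"
  then have "finite Y"
    by (metis Diff_eq_empty_iff finite.emptyI finite.insertI finite_subset)
  with assms show False
    using finite_imp_not_open by blast
qed

text \<open>Any simplex through \<open>x0\<close> contains the triangle \<open>t0\<close>. Hence the
  puncture stays clear of all vertices and edges.\<close>

lemma x0_mem_imp: "\<lbrakk>S \<in> K; x0 \<in> S\<rbrakk> \<Longrightarrow> aff_dim S = 2"
  by (metis aff_dim_subset antisym dim_le rel_interior_meets_imp_subset t0)

text \<open>A maximal simplex is its own open star, so its relative interior is open in the
  realization and pulls back to a nonempty open set of the plane. Off the poles \<open>g\<close>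
  maps this set continuously and injectively into the affine hull, which by invariance of dimension
  cannot have dimension below 2.\<close>

lemma purity:
  assumes "S \<in> K" "S \<noteq> {}"
  obtains t where "t \<in> faces" "S \<subseteq> t"
proof -
  obtain M where M: "M \<in> K" "S \<subseteq> M" and max: "\<And>S'. \<lbrakk>S' \<in> K; M \<subseteq> S'\<rbrakk> \<Longrightarrow> S' = M"
    using finite_has_maximal2 [OF finite_complex assms(1)] by auto
  have "aff_dim M = 2"
  proof (rule ccontr)
    assume "aff_dim M \<noteq> 2"
    then have dimM: "aff_dim M \<le> 1"
      using dim_le [OF M(1)] by simp
    have "{S' \<in> K. M \<subseteq> S'} = {M}"
      using M max by auto
    then have "openin (top_of_set (\<Union>K)) (rel_interior M)"
      using openin_open_star [OF M(1)] by simp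
    then have op: "open (g -` rel_interior M)"
      by (rule open_vimage_openin)
    have "rel_interior M \<noteq> {}"
      using M assms by (simp add: complex_convex rel_interior_eq_empty) blast
    then obtain y where y: "y \<in> rel_interior M"
      by blast
    then have "y \<in> M"
      using rel_interior_subset by blast
    then have "y \<in> range g"
      using range_g x0_mem_imp [OF M(1)] M \<open>aff_dim M \<noteq> 2\<close> by auto
    then have ne: "g -` rel_interior M \<noteq> {}"
      using y by auto
    have "aff_dim (UNIV :: complex set) \<le> aff_dim (affine hull M)"
    proof (rule invariance_of_dimension_affine_sets)
      show "openin (top_of_set UNIV) (g -` rel_interior M - {\<alpha>, \<beta>})"
        using op by (simp add: open_Diff)
      show "g \<in> (g -` rel_interior M - {\<alpha>, \<beta>}) \<rightarrow> affine hull M"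
        using rel_interior_subset hull_subset by fastforce
      show "inj_on g (g -` rel_interior M - {\<alpha>, \<beta>})"
        using inj_on_g by (rule inj_on_subset) auto
      show "g -` rel_interior M - {\<alpha>, \<beta>} \<noteq> {}"
        using open_minus_poles_nonempty [OF op ne] .
      show "continuous_on (g -` rel_interior M - {\<alpha>, \<beta>}) g"
        using cont continuous_on_subset by blast
    qed auto
    then show False
      using dimM by simp
  qed
  then show ?thesis
    using that M by (auto simp: faces_def)
qed

text \<open>Small neighbourhoods have open images, and the relative interior is dense in
  \<open>t\<close>. At a pole this would fail: a triangle at \<open>q\<close> may reach it through
  the other pole only.\<close>

lemma rel_interior_face_dense:
  assumes "open Y" "z \<in> Y" "z \<notin> {\<alpha>, \<beta>}" "g z \<in> t" "t \<in> K"
  shows "Y \<inter> g -` rel_interior t \<noteq> {}"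
proof -
  have "openin (top_of_set (\<Union>K)) (g ` (Y - {\<alpha>, \<beta>}))"
    by (rule open_sat) (use assms in \<open>auto simp: open_Diff\<close>)
  then obtain W where W: "open W" "g ` (Y - {\<alpha>, \<beta>}) = \<Union>K \<inter> W"
    by (meson openin_open)
  then have "g z \<in> W"
    using assms by blast
  then have "W \<inter> closure (rel_interior t) \<noteq> {}"
    using assms closure_rel_interior_complex by auto
  then have "W \<inter> rel_interior t \<noteq> {}"
    using W(1) open_Int_closure_eq_empty by blast
  then obtain y where "y \<in> W" "y \<in> rel_interior t"
    by blast
  then have "y \<in> g ` (Y - {\<alpha>, \<beta>})"
    using W assms(5) rel_interior_subset by blast
  then show ?thesis
    using \<open>y \<in> rel_interior t\<close> by blast
qed

lemma faces_dense:
  assumes "open Y" "Y \<noteq> {}"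
  obtains t where "t \<in> faces" "Y \<inter> g -` rel_interior t \<noteq> {}"
proof -
  obtain z where z: "z \<in> Y" "z \<notin> {\<alpha>, \<beta>}"
    using open_minus_poles_nonempty [OF assms] by blast
  obtain S where "S \<in> K" "g z \<in> S"
    using g_mem by blast
  then obtain t where "t \<in> faces" "g z \<in> t"
    using purity by (metis empty_iff subsetD)
  then show ?thesis
    using that rel_interior_face_dense [OF assms(1) z] by (auto simp: faces_def)
qed

section \<open>Local structure at the pinch point\<close>

lemma near_pinch:
  assumes "0 < \<epsilon>"
  obtains d where "0 < d" "\<Union>K \<inter> ball q d \<subseteq> g ` (ball \<alpha> \<epsilon> \<union> ball \<beta> \<epsilon>)"
proof -
  have op: "openin (top_of_set (\<Union>K)) (g ` (ball \<alpha> \<epsilon> \<union> ball \<beta> \<epsilon>))"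
    by (rule open_sat) (use assms in auto)
  moreover have "q \<in> g ` (ball \<alpha> \<epsilon> \<union> ball \<beta> \<epsilon>)"
    using assms poles by (metis UnI1 centre_in_ball image_eqI)
  ultimately show ?thesis
    using that by (metis openin_contains_ball inf_commute)
qed

definition "\<eta> = dist \<alpha> \<beta> / 2"

lemma eta_pos: "0 < \<eta>"
  using poles by (simp add: \<eta>_def)

lemma pole_balls_disjoint: "ball \<alpha> \<eta> \<inter> ball \<beta> \<eta> = {}"
  by (rule disjoint_ballI) (simp add: \<eta>_def)

lemma pole_balls_disjointD: "\<lbrakk>dist \<alpha> z < \<eta>; dist \<beta> z < \<eta>\<rbrakk> \<Longrightarrow> False"
  using pole_balls_disjoint by auto

lemma other_pole_notin_ball: "\<beta> \<notin> ball \<alpha> \<eta>" "\<alpha> \<notin> ball \<beta> \<eta>"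
  using eta_pos by (auto simp: \<eta>_def dist_commute)

text \<open>Without \<open>q\<close>, the part of the realization near it splits into two disjoint
  open pieces, the images of the punctured discs around the poles.\<close>

lemma connected_near_pinch_cases:
  assumes "connected N" "N \<subseteq> \<Union>K - {q}" "N \<subseteq> g ` (ball \<alpha> \<eta> \<union> ball \<beta> \<eta>)"
  shows "N \<subseteq> g ` (ball \<alpha> \<eta> - {\<alpha>}) \<or> N \<subseteq> g ` (ball \<beta> \<eta> - {\<beta>})"
proof (rule connected_openin_cases [where X = "\<Union>K"])
  show "openin (top_of_set (\<Union>K)) (g ` (ball \<alpha> \<eta> - {\<alpha>}))"
    "openin (top_of_set (\<Union>K)) (g ` (ball \<beta> \<eta> - {\<beta>}))"
    using other_pole_notin_ball by (auto intro!: open_sat)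
  show "g ` (ball \<alpha> \<eta> - {\<alpha>}) \<inter> g ` (ball \<beta> \<eta> - {\<beta>}) = {}"
    using pole_balls_disjoint other_pole_notin_ball g_eqD by blast
  show "N \<subseteq> g ` (ball \<alpha> \<eta> - {\<alpha>}) \<union> g ` (ball \<beta> \<eta> - {\<beta>})"
  proof
    fix x assume "x \<in> N"
    then obtain z where "x = g z" "z \<in> ball \<alpha> \<eta> \<union> ball \<beta> \<eta>" "x \<noteq> q"
      using assms by blast
    then show "x \<in> g ` (ball \<alpha> \<eta> - {\<alpha>}) \<union> g ` (ball \<beta> \<eta> - {\<beta>})"
      using poles by blast
  qed
qed (use assms in auto)

text \<open>Near \<open>q\<close> the set \<open>C\<close> is convex, hence in one of the two
  pieces, which fixes \<open>w\<close>. The same \<open>w\<close> serves every smaller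
  \<open>\<epsilon>\<close>, since the discs of radius \<open>\<eta>\<close> around the poles are
  disjoint and \<open>g\<close> is injective off the poles.\<close>

lemma convex_end:
  assumes "convex C" "C \<subseteq> \<Union>K - {q}"
  obtains w where "w \<in> {\<alpha>, \<beta>}" "\<And>\<epsilon>. 0 < \<epsilon> \<Longrightarrow> \<exists>d>0. C \<inter> ball q d \<subseteq> g ` ball w \<epsilon>"
proof -
  obtain d1 where d1: "0 < d1" "\<Union>K \<inter> ball q d1 \<subseteq> g ` (ball \<alpha> \<eta> \<union> ball \<beta> \<eta>)"
    using near_pinch eta_pos by blast
  have "connected (C \<inter> ball q d1)"
    using assms by (simp add: convex_Int convex_connected)
  then have "C \<inter> ball q d1 \<subseteq> g ` (ball \<alpha> \<eta> - {\<alpha>}) \<or> C \<inter> ball q d1 \<subseteq> g ` (ball \<beta> \<eta> - {\<beta>})"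
    by (rule connected_near_pinch_cases) (use d1 assms in auto)
  then obtain w where w: "w \<in> {\<alpha>, \<beta>}" "C \<inter> ball q d1 \<subseteq> g ` (ball w \<eta> - {w})"
    by blast
  have "\<exists>d>0. C \<inter> ball q d \<subseteq> g ` ball w \<epsilon>" if "0 < \<epsilon>" for \<epsilon>
  proof -
    obtain d2 where d2: "0 < d2" "\<Union>K \<inter> ball q d2 \<subseteq> g ` (ball \<alpha> (min \<epsilon> \<eta>) \<union> ball \<beta> (min \<epsilon> \<eta>))"
      using near_pinch eta_pos \<open>0 < \<epsilon>\<close> by (metis min_less_iff_conj)
    have "C \<inter> ball q (min d1 d2) \<subseteq> g ` ball w \<epsilon>"
    proof
      fix x assume x: "x \<in> C \<inter> ball q (min d1 d2)"
      then have "x \<in> C \<inter> ball q d1" "x \<in> \<Union>K \<inter> ball q d2"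
        using assms(2) by auto
      then obtain y z where y: "x = g y" "y \<in> ball w \<eta> - {w}"
        and z: "x = g z" "z \<in> ball \<alpha> (min \<epsilon> \<eta>) \<union> ball \<beta> (min \<epsilon> \<eta>)"
        using w d2 by blast
      have "y \<notin> {\<alpha>, \<beta>}"
        using y w other_pole_notin_ball by auto
      then have "y = z"
        using y z g_eqD by blast
      then have "y \<in> ball w \<epsilon>"
        using y z w pole_balls_disjointD by auto
      then show "x \<in> g ` ball w \<epsilon>"
        using y by blast
    qed
    then show ?thesis
      using d1 d2 by (metis min_less_iff_conj)
  qed
  then show ?thesis
    using that w by blast
qed

lemma point_near_pole:
  assumes "0 < d" "0 < \<epsilon>" "w \<in> {\<alpha>, \<beta>}"
  obtains z where "z \<in> ball w \<epsilon>" "z \<notin> {\<alpha>, \<beta>}" "g z \<in> ball q d"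
proof -
  have "open (ball w \<epsilon> \<inter> g -` ball q d)"
    using cont by (simp add: open_Int open_vimage)
  moreover have "w \<in> ball w \<epsilon> \<inter> g -` ball q d"
    using assms poles by auto
  ultimately have "ball w \<epsilon> \<inter> g -` ball q d - {\<alpha>, \<beta>} \<noteq> {}"
    using open_minus_poles_nonempty by blast
  then show ?thesis
    using that by blast
qed

text \<open>Suppose the carrier \<open>S\<close> of \<open>q\<close> has positive dimension. Every
  triangle at \<open>q\<close> then contains \<open>S\<close>, so near \<open>q\<close> they share a
  point \<open>y\<close> other than \<open>q\<close>; each stays connected without \<open>q\<close>,
  hence so does their union \<open>N\<close>. But \<open>N\<close> comes close to both poles, while
  a connected set close to \<open>q\<close> belongs to one pole.\<close>

lemma pinch_vertex: "{q} \<in> K"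
proof -
  have "q \<in> \<Union>K"
    using g_mem poles by metis
  then obtain S where S: "S \<in> K" "q \<in> rel_interior S"
    using carrier_simplex by blast
  then have qS: "q \<in> S"
    using rel_interior_subset by blast
  have "aff_dim S = 0"
  proof (rule ccontr)
    assume ndim: "aff_dim S \<noteq> 0"
    obtain d0 where d0: "0 < d0" "\<And>S. \<lbrakk>S \<in> K; S \<inter> ball q d0 \<noteq> {}\<rbrakk> \<Longrightarrow> q \<in> S"
      using near_point_simplices by blast
    obtain d1 where d1: "0 < d1" "\<Union>K \<inter> ball q d1 \<subseteq> g ` (ball \<alpha> \<eta> \<union> ball \<beta> \<eta>)"
      using near_pinch eta_pos by blast
    define d where "d = min d0 d1"
    have d: "0 < d" "ball q d \<subseteq> ball q d0" "ball q d \<subseteq> ball q d1"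
      using d0 d1 by (auto simp: d_def)
    define N where "N = (\<Union>t\<in>{t \<in> faces. q \<in> t}. t \<inter> ball q d - {q})"
    have "aff_dim (S \<inter> ball q d) \<noteq> 0"
      using ndim S d qS aff_dim_convex_Int_open [of S "ball q d"] complex_convex
      by (metis IntI centre_in_ball empty_iff open_ball)
    then have "S \<inter> ball q d \<noteq> {q}"
      by auto
    moreover have "q \<in> S \<inter> ball q d"
      using qS d by auto
    ultimately obtain y where y: "y \<in> S" "y \<in> ball q d" "y \<noteq> q"
      by blast
    have "connected N"
      unfolding N_def
    proof (rule connected_Union)
      fix C assume "C \<in> (\<lambda>t. t \<inter> ball q d - {q}) ` {t \<in> faces. q \<in> t}"
      then obtain t where t: "t \<in> K" "aff_dim t = 2" "q \<in> t" "C = t \<inter> ball q d - {q}"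
        by (auto simp: faces_def)
      have "aff_dim (t \<inter> ball q d) = 2"
        using t d aff_dim_convex_Int_open [of t "ball q d"] complex_convex
        by (metis IntI centre_in_ball empty_iff open_ball)
      then show "connected C"
        unfolding t by (intro connected_punctured_convex) (auto simp: t complex_convex convex_Int)
    next
      have "y \<in> \<Inter>((\<lambda>t. t \<inter> ball q d - {q}) ` {t \<in> faces. q \<in> t})"
        using y S rel_interior_meets_imp_subset [OF S(1) _ S(2)] by (auto simp: faces_def)
      then show "\<Inter>((\<lambda>t. t \<inter> ball q d - {q}) ` {t \<in> faces. q \<in> t}) \<noteq> {}"
        by blast
    qed
    then have alt: "N \<subseteq> g ` (ball \<alpha> \<eta> - {\<alpha>}) \<or> N \<subseteq> g ` (ball \<beta> \<eta> - {\<beta>})"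
      by (rule connected_near_pinch_cases) (use d d1 in \<open>auto simp: N_def faces_def\<close>)
    \<comment> \<open>Points close to \<open>w\<close> are mapped close to \<open>q\<close>, where
      by the choice of \<open>d0\<close> only simplices through \<open>q\<close> are left.\<close>
    have near: "\<exists>z \<in> ball w \<eta> - {\<alpha>, \<beta>}. g z \<in> N" if w: "w \<in> {\<alpha>, \<beta>}" for w
    proof -
      obtain z where z: "z \<in> ball w \<eta>" "z \<notin> {\<alpha>, \<beta>}" "g z \<in> ball q d"
        using point_near_pole [OF d(1) eta_pos w] by blast
      obtain S where "S \<in> K" "g z \<in> S"
        using g_mem by blast
      then obtain t where "t \<in> faces" "g z \<in> t"
        using purity by (metis empty_iff subsetD)
      moreover have "q \<in> t"
        by (rule d0(2)) (use \<open>t \<in> faces\<close> \<open>g z \<in> t\<close> z(3) d(2) in \<open>auto simp: faces_def\<close>)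
      moreover have "g z \<noteq> q"
        using z g_eq_q_iff by blast
      ultimately have "g z \<in> N"
        using z by (auto simp: N_def)
      then show ?thesis
        using z by blast
    qed
    from alt show False
    proof
      assume N: "N \<subseteq> g ` (ball \<alpha> \<eta> - {\<alpha>})"
      obtain z where z: "z \<in> ball \<beta> \<eta>" "z \<notin> {\<alpha>, \<beta>}" "g z \<in> N"
        using near [of \<beta>] by blast
      then obtain y where "y \<in> ball \<alpha> \<eta>" "g z = g y"
        using N by blast
      then show False
        using z g_eqD [of z y] pole_balls_disjointD by auto
    next
      assume N: "N \<subseteq> g ` (ball \<beta> \<eta> - {\<beta>})"
      obtain z where z: "z \<in> ball \<alpha> \<eta>" "z \<notin> {\<alpha>, \<beta>}" "g z \<in> N"
        using near [of \<alpha>] by blast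
      then obtain y where "y \<in> ball \<beta> \<eta>" "g z = g y"
        using N by blast
      then show False
        using z g_eqD [of z y] pole_balls_disjointD by auto
    qed
  qed
  then have "S = {q}"
    using qS by (metis aff_dim_eq_0 singletonD)
  then show ?thesis
    using S by simp
qed

lemma vertex_rel_interior:
  assumes "{v} \<in> K" "S \<in> K" "v \<in> rel_interior S"
  shows "S = {v}"
  using rel_interior_inj [OF assms(2,1,3)] by simp

lemma pinch_notin_rel_interior: "\<lbrakk>S \<in> K; aff_dim S > 0\<rbrakk> \<Longrightarrow> q \<notin> rel_interior S"
  using vertex_rel_interior [OF pinch_vertex] by force

lemma convex_minus_vertex:
  assumes "S \<in> K" "{v} \<in> K"
  shows "convex (S - {v})"
proof (cases "v \<in> S")
  case True
  then have "{v} face_of S"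
    using complex_Int [OF assms] by (simp add: Int_absorb1)
  then show ?thesis
    using extreme_point_of_stillconvex [OF complex_convex [OF assms(1)]]
    by (simp add: face_of_singleton)
next
  case False
  then show ?thesis
    using assms complex_convex by simp
qed

section \<open>Lifting the edges to arcs\<close>

lemma x0_notin_edge: "e \<in> edges \<Longrightarrow> x0 \<notin> e"
  using x0_mem_imp by (fastforce simp: edges_def)

text \<open>Oriented so that only the start \<open>a\<close> can be the pinch point; a lift then has
  a single delicate end.\<close>

lemma edge_endpoints:
  assumes "e \<in> edges"
  obtains a b where "a \<noteq> b" "e = closed_segment a b" "rel_interior e = open_segment a b"
    "{a} \<in> K" "{b} \<in> K" "b \<noteq> q"
proof -
  have eK: "e \<in> K" and "1 simplex e"
    using assms complex_simplex_iff by (auto simp: edges_def)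
  then obtain a b where ab: "a \<noteq> b" "e = closed_segment a b"
    by (meson simplexE_1)
  have v: "{a} \<in> K" "{b} \<in> K"
    using subface_mem [OF eK, of "{a, b}" "{a}"] subface_mem [OF eK, of "{a, b}" "{b}"] ab
    by (auto simp: segment_convex_hull)
  show ?thesis
  proof (cases "b = q")
    case False
    with that [of a b] ab v show ?thesis
      by (simp add: rel_interior_closed_segment)
  next
    case True
    with that [of b a] ab v show ?thesis
      by (simp add: rel_interior_closed_segment closed_segment_commute open_segment_commute)
  qed
qed

text \<open>\<open>\<psi>\<close> lifts the segment on the half-open parameter range, and the only
  question is the limit at its start. If the start is \<open>q\<close>, the edge without
  \<open>q\<close> is convex and so approaches a single pole.\<close>

lemma edge_lift:
  assumes e: "e \<in> edges"
  shows "\<exists>p. arc p \<and> path_image p = {pathstart p, pathfinish p} \<union> g -` rel_interior e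
           \<and> e = closed_segment (g (pathstart p)) (g (pathfinish p))"
proof -
  obtain a b where ab: "a \<noteq> b" "e = closed_segment a b" "rel_interior e = open_segment a b"
    "{a} \<in> K" "{b} \<in> K" "b \<noteq> q"
    using edge_endpoints e by blast
  have eK: "e \<in> K" "aff_dim e = 1"
    using e by (auto simp: edges_def)
  define l where "l = linepath a b"
  have l_inj: "inj_on l {0..1}"
    using ab arc_linepath [of a b] by (simp add: l_def arc_def)
  have l_mem: "l t \<in> e" if "t \<in> {0..1}" for t
    using that linepath_in_path [of t a b] by (simp add: l_def ab)
  have l_ne_q: "l t \<noteq> q" if "t \<in> {0<..1}" for t
  proof (cases "t = 1")
    case False
    then have "l t \<in> open_segment a b"
      using that ab by (auto simp: l_def linepath_def in_segment)
    then show ?thesis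
      using pinch_notin_rel_interior [of e] eK ab by auto
  qed (use ab in \<open>simp add: l_def linepath_def\<close>)
  have l_psi: "l ` {0<..1} \<subseteq> \<Union>K - {q, x0}"
  proof
    fix y assume "y \<in> l ` {0<..1}"
    then obtain t where "t \<in> {0<..1}" "y = l t"
      by blast
    then show "y \<in> \<Union>K - {q, x0}"
      using l_mem [of t] l_ne_q x0_notin_edge [OF e] eK by auto
  qed
  have cont_l: "continuous_on A l" for A
    unfolding l_def by (rule continuous_on_linepath)
  obtain w where w: "g w = a" and lim: "((\<lambda>t. \<psi> (l t)) \<longlongrightarrow> w) (at 0 within {0<..1})"
  proof (cases "a = q")
    case False
    have a: "a \<in> \<Union>K - {q, x0}"
      using False ab eK x0_notin_edge [OF e] by auto
    have l0: "l 0 = a"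
      by (simp add: l_def linepath_def)
    have "l ` {0..1} \<subseteq> \<Union>K - {q, x0}"
    proof
      fix y assume "y \<in> l ` {0..1}"
      then obtain t where t: "t \<in> {0..1}" "y = l t"
        by blast
      show "y \<in> \<Union>K - {q, x0}"
      proof (cases "t = 0")
        case True
        then show ?thesis
          using a l0 t by simp
      next
        case False
        then have "t \<in> {0<..1}"
          using t by auto
        then show ?thesis
          using l_psi t by blast
      qed
    qed
    then have "continuous_on {0..1} (\<lambda>t. \<psi> (l t))"
      using continuous_on_compose2 [OF continuous_on_psi cont_l] by blast
    then have "((\<lambda>t. \<psi> (l t)) \<longlongrightarrow> \<psi> (l 0)) (at 0 within {0..1})"
      by (simp add: continuous_on_def)
    then have "((\<lambda>t. \<psi> (l t)) \<longlongrightarrow> \<psi> a) (at 0 within {0<..1})"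
      using l0 tendsto_within_subset [of _ _ 0 "{0..1}" "{0<..1}"] by fastforce
    then show ?thesis
      using that [of "\<psi> a"] g_psi a by blast
  next
    case True
    have conv: "convex (e - {q})"
      using convex_minus_vertex eK pinch_vertex by blast
    have sub: "e - {q} \<subseteq> \<Union>K - {q}"
      using eK by blast
    obtain w where w: "w \<in> {\<alpha>, \<beta>}"
      and near: "\<And>\<epsilon>. 0 < \<epsilon> \<Longrightarrow> \<exists>d>0. (e - {q}) \<inter> ball q d \<subseteq> g ` ball w \<epsilon>"
      by (rule convex_end [OF conv sub]) (rule that)
    have "((\<lambda>t. \<psi> (l t)) \<longlongrightarrow> w) (at 0 within {0<..1})"
    proof (rule tendstoI)
      fix \<epsilon> :: real
      assume "0 < \<epsilon>"
      then obtain d where d: "0 < d" "(e - {q}) \<inter> ball q d \<subseteq> g ` ball w \<epsilon>"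
        using near by blast
      have "(l \<longlongrightarrow> l 0) (at 0 within {0<..1})"
        using cont_l [of UNIV] by (metis UNIV_I continuous_on_def tendsto_within_subset subset_UNIV)
      then have "\<forall>\<^sub>F t in at 0 within {0<..1}. dist (l t) (l 0) < d"
        using d by (simp add: tendstoD)
      moreover have "\<forall>\<^sub>F t in at 0 within {0<..1::real}. t \<in> {0<..1}"
        by (simp add: eventually_at_filter)
      ultimately show "\<forall>\<^sub>F t in at 0 within {0<..1}. dist (\<psi> (l t)) w < \<epsilon>"
      proof eventually_elim
        fix t :: real
        assume t: "dist (l t) (l 0) < d" "t \<in> {0<..1}"
        have "l 0 = q"
          using True by (simp add: l_def linepath_def)
        then have "l t \<in> (e - {q}) \<inter> ball q d"
          using t l_mem [of t] l_ne_q [of t] by (auto simp: dist_commute)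
        then obtain y where y: "l t = g y" "y \<in> ball w \<epsilon>"
          using d by blast
        then have "y \<notin> {\<alpha>, \<beta>}"
          using l_ne_q [OF t(2)] g_eq_q_iff by metis
        then have "\<psi> (l t) = y"
          using y psi_g by metis
        then show "dist (\<psi> (l t)) w < \<epsilon>"
          using y by (simp add: dist_commute)
      qed
    qed
    then show ?thesis
      using that [of w] w True g_eq_q_iff by blast
  qed
  \<comment> \<open>Putting the limit at 0 matters when \<open>a = q\<close>, where
    \<open>\<psi>\<close> is arbitrary. Injectivity of \<open>p\<close> follows from that of
    \<open>l\<close>, because \<open>g\<close> maps \<open>p t\<close> to
    \<open>l t\<close>.\<close>
  define p where "p = (\<lambda>t. if t = 0 then w else \<psi> (l t))"
  have gp: "g (p t) = l t" if "t \<in> {0..1}" for t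
  proof (cases "t = 0")
    case True
    then show ?thesis
      using w by (simp add: p_def l_def linepath_def)
  next
    case False
    then have "l t \<in> \<Union>K - {q, x0}"
      using l_psi that by (metis greaterThanAtMost_iff atLeastAtMost_iff image_subset_iff less_eq_real_def)
    then show ?thesis
      using False g_psi by (simp add: p_def)
  qed
  have "continuous_on {0..1} p"
    unfolding continuous_on_def
  proof
    fix t :: real
    assume t: "t \<in> {0..1}"
    show "(p \<longlongrightarrow> p t) (at t within {0..1})"
    proof (cases "t = 0")
      case True
      have "(p \<longlongrightarrow> w) (at 0 within {0<..1})"
        using lim by (rule Lim_transform_eventually) (auto simp: eventually_at_filter p_def)
      moreover have "at 0 within {0<..1} = at 0 within {0..1::real}"
        by (rule at_within_nhd [of 0 UNIV]) auto
      ultimately show ?thesis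
        using True by (simp add: p_def)
    next
      case False
      have "continuous_on {0<..1} (\<lambda>t. \<psi> (l t))"
        using continuous_on_compose2 [OF continuous_on_psi cont_l l_psi] .
      then have "((\<lambda>t. \<psi> (l t)) \<longlongrightarrow> \<psi> (l t)) (at t within {0<..1})"
        using t False by (auto simp: continuous_on_def)
      then have "(p \<longlongrightarrow> \<psi> (l t)) (at t within {0<..1})"
        by (rule Lim_transform_eventually) (auto simp: eventually_at_filter p_def)
      moreover have "at t within {0<..1} = at t within {0..1::real}"
        by (rule at_within_nhd [of t "{0<..}"]) (use t False in auto)
      ultimately show ?thesis
        using False by (simp add: p_def)
    qed
  qed
  moreover have "inj_on p {0..1}"
    using l_inj gp unfolding inj_on_def by metis
  ultimately have "arc p"
    by (simp add: arc_def path_def)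
  have ends: "g (pathstart p) = a" "g (pathfinish p) = b"
    using gp [of 0] gp [of 1] by (auto simp: pathstart_def pathfinish_def l_def linepath_def)
  have "path_image p = {pathstart p, pathfinish p} \<union> g -` open_segment a b"
  proof (intro equalityI subsetI)
    fix z assume "z \<in> path_image p"
    then obtain t where t: "t \<in> {0..1}" "z = p t"
      by (auto simp: path_image_def)
    have "l t \<in> open_segment a b" if "t \<noteq> 0" "t \<noteq> 1"
      using that t ab unfolding l_def linepath_def in_segment by (intro conjI exI [of _ t]) auto
    then show "z \<in> {pathstart p, pathfinish p} \<union> g -` open_segment a b"
      using t gp by (auto simp: pathstart_def pathfinish_def)
  next
    fix z assume z: "z \<in> {pathstart p, pathfinish p} \<union> g -` open_segment a b"
    show "z \<in> path_image p"
    proof (cases "z \<in> {pathstart p, pathfinish p}")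
      case False
      then have "g z \<in> open_segment a b"
        using z by auto
      then obtain t where t: "0 < t" "t < 1" "g z = l t"
        by (auto simp: in_segment l_def linepath_def)
      then have "z \<notin> {\<alpha>, \<beta>}"
        using l_ne_q [of t] poles by auto
      then have "p t = z"
        using t psi_g by (metis less_irrefl p_def)
      then show ?thesis
        using t by (auto simp: path_image_def)
    qed auto
  qed
  then show ?thesis
    using \<open>arc p\<close> ends ab by auto
qed

definition "edge_path e = (SOME p. arc p \<and> path_image p = {pathstart p, pathfinish p} \<union> g -` rel_interior e
           \<and> e = closed_segment (g (pathstart p)) (g (pathfinish p)))"

definition "edge_image e = path_image (edge_path e)"
definition "edge_ends e = {pathstart (edge_path e), pathfinish (edge_path e)}"
definition "lifted_verts = g -` verts"

lemma
  assumes "e \<in> edges"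
  shows arc_edge_path: "arc (edge_path e)"
    and edge_image_eq: "edge_image e = edge_ends e \<union> g -` rel_interior e"
    and edge_eq_segment: "e = closed_segment (g (pathstart (edge_path e))) (g (pathfinish (edge_path e)))"
  using someI_ex [OF edge_lift [OF assms]] unfolding edge_path_def edge_image_def edge_ends_def by blast+

lemma edge_eq_hull: "e \<in> edges \<Longrightarrow> e = convex hull (g ` edge_ends e)"
  using edge_eq_segment by (auto simp: edge_ends_def segment_convex_hull)

lemma edge_ends_subset: "e \<in> edges \<Longrightarrow> edge_ends e \<subseteq> lifted_verts"
proof -
  assume e: "e \<in> edges"
  then have eK: "e \<in> K"
    by (simp add: edges_def)
  have "e = convex hull {g (pathstart (edge_path e)), g (pathfinish (edge_path e))}"
    using edge_eq_hull [OF e] by (simp add: edge_ends_def)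
  from subface_mem [OF eK this affine_independent_2]
  have "convex hull {g (pathstart (edge_path e))} \<in> K" "convex hull {g (pathfinish (edge_path e))} \<in> K"
    by blast+
  then show ?thesis
    by (auto simp: edge_ends_def lifted_verts_def verts_def)
qed

lemma rel_interior_lifted_verts:
  assumes "S \<in> K" "aff_dim S > 0"
  shows "g -` rel_interior S \<inter> lifted_verts = {}"
  using vertex_rel_interior [OF _ assms(1)] assms(2) by (force simp: lifted_verts_def verts_def)

lemma edge_image_Int_verts: "e \<in> edges \<Longrightarrow> edge_image e \<inter> lifted_verts = edge_ends e"
  using edge_image_eq edge_ends_subset rel_interior_lifted_verts [of e] by (auto simp: edges_def)

text \<open>Open edges are disjoint, so a common point of two lifted edges is a lifted vertex, and
  on a lifted edge such a vertex can only be an end.\<close>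

lemma edge_image_Int:
  assumes "e \<in> edges" "e' \<in> edges" "e \<noteq> e'"
  shows "edge_image e \<inter> edge_image e' \<subseteq> edge_ends e \<inter> edge_ends e'"
proof -
  have "g -` rel_interior e \<inter> g -` rel_interior e' = {}"
    using assms rel_interior_inj by (auto simp: edges_def)
  then have "edge_image e \<inter> edge_image e' \<subseteq> lifted_verts"
    using edge_image_eq edge_ends_subset assms by blast
  then show ?thesis
    using edge_image_Int_verts assms by blast
qed

section \<open>Incidences between vertices, edges and triangles\<close>

lemma finite_verts: "finite verts"
proof -
  have "(\<lambda>v. {v}) ` verts \<subseteq> K"
    by (auto simp: verts_def)
  then show ?thesis
    using finite_complex finite_subset finite_imageD by (metis inj_singleton inj_on_subset subset_UNIV)
qed

text \<open>\<open>x0\<close>, the only point of the realization without a lift, is no vertex; so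
  every vertex is counted, and only the pinch twice.\<close>

lemma card_lifted_verts: "finite lifted_verts" "card lifted_verts = card verts + 1"
proof -
  have x0: "x0 \<notin> verts"
    using x0_mem_imp by (force simp: verts_def)
  have q: "q \<in> verts"
    using pinch_vertex by (simp add: verts_def)
  have V: "v \<in> \<Union>K" if "v \<in> verts" for v
    using that by (auto simp: verts_def)
  have eq: "lifted_verts = {\<alpha>, \<beta>} \<union> \<psi> ` (verts - {q})" (is "?l = ?r")
  proof (intro equalityI subsetI)
    fix z assume z: "z \<in> ?l"
    then have gz: "g z \<in> verts"
      by (simp add: lifted_verts_def)
    show "z \<in> ?r"
    proof (cases "z \<in> {\<alpha>, \<beta>}")
      case False
      then have "g z \<noteq> q" "z = \<psi> (g z)"
        using g_eq_q_iff psi_g by auto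
      then show ?thesis
        using gz by blast
    qed auto
  next
    fix z assume "z \<in> ?r"
    then consider "z \<in> {\<alpha>, \<beta>}" | v where "z = \<psi> v" "v \<in> verts" "v \<noteq> q"
      by blast
    then show "z \<in> ?l"
    proof cases
      case 1
      then show ?thesis
        using q poles by (auto simp: lifted_verts_def)
    next
      case 2
      then have "g z = v"
        using g_psi V x0 by metis
      then show ?thesis
        using 2 by (simp add: lifted_verts_def)
    qed
  qed
  show "finite lifted_verts"
    using eq finite_verts by simp
  have gpsi: "g (\<psi> v) = v" "\<psi> v \<notin> {\<alpha>, \<beta>}" if "v \<in> verts - {q}" for v
    using g_psi [of v] psi_nonpole [of v] V x0 that by blast+
  have "inj_on \<psi> (verts - {q})"
    by (rule inj_on_inverseI [where g = g]) (use gpsi in auto)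
  then have "card (\<psi> ` (verts - {q})) = card (verts - {q})"
    by (rule card_image)
  moreover have "w \<notin> {\<alpha>, \<beta>}" if "w \<in> \<psi> ` (verts - {q})" for w
    using that gpsi(2) by (elim imageE) simp
  then have disj: "{\<alpha>, \<beta>} \<inter> \<psi> ` (verts - {q}) = {}"
    by (meson disjoint_iff)
  moreover have "Suc (card (verts - {q})) = card verts"
    using q finite_verts by (metis card_Suc_Diff1)
  ultimately show "card lifted_verts = card verts + 1"
    unfolding eq using finite_verts poles disj by (subst card_Un_disjoint) auto
qed

text \<open>Two triangles glued along \<open>e\<close> form a planar disc, whose image under
  \<open>\<psi>\<close> is open by invariance of domain. It contains points over \<open>e\<close>,
  so by density the interior of a third triangle at \<open>e\<close> would have to enter it.\<close>

lemma edge_in_two_faces: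
  assumes e: "e \<in> edges" "t1 \<in> faces" "t2 \<in> faces" "t3 \<in> faces" "e \<subseteq> t1" "e \<subseteq> t2" "e \<subseteq> t3"
    and ne: "t1 \<noteq> t2"
  shows "t3 = t1 \<or> t3 = t2"
proof (rule ccontr)
  assume t3: "\<not> ?thesis"
  obtain a b where ab: "a \<noteq> b" "e = closed_segment a b" "rel_interior e = open_segment a b"
    using edge_endpoints e(1) by blast
  have eK: "e \<in> K" and dime: "aff_dim e = 1"
    using e by (auto simp: edges_def)
  have tK: "t1 \<in> K" "t2 \<in> K" "t3 \<in> K" and tdim: "aff_dim t1 = 2" "aff_dim t2 = 2"
    using e by (auto simp: faces_def)
  obtain c1 where c1: "t1 = convex hull {a, b, c1}" "\<not> affine_dependent {a, b, c1}" "c1 \<noteq> a" "c1 \<noteq> b"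
    using triangle_over_edge [OF tK(1) tdim(1)] ab eK e by metis
  obtain c2 where c2: "t2 = convex hull {a, b, c2}" "\<not> affine_dependent {a, b, c2}" "c2 \<noteq> a" "c2 \<noteq> b"
    using triangle_over_edge [OF tK(2) tdim(2)] ab eK e by metis
  \<comment> \<open>\<open>F\<close> folds a planar triangle along the real axis onto the two triangles, so \<open>t1\<close> and \<open>t2\<close> already fill a disc around the open edge.\<close>
  define F where "F = (\<lambda>z. a + Re z *\<^sub>R (b - a) + max (Im z) 0 *\<^sub>R (c1 - a) + max (- Im z) 0 *\<^sub>R (c2 - a))"
  \<comment> \<open>The condition \<open>F z \<noteq> x0\<close> keeps \<open>\<psi>\<close>
    continuous on the image of \<open>U\<close>, in case one of the triangles is
    \<open>t0\<close>.\<close>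
  define U where "U = {z. 0 < Re z \<and> Re z + \<bar>Im z\<bar> < 1 \<and> F z \<noteq> x0}"
  have contF: "continuous_on A F" for A
    unfolding F_def by (intro continuous_intros)
  have opU: "open U"
    unfolding U_def using contF
    by (intro open_Collect_conj open_Collect_less open_Collect_neq continuous_intros) auto
  have F1: "F z \<in> rel_interior t1" if "z \<in> U" "Im z > 0" for z
    using rel_interior_triangle_mem [OF c1(2), of "Re z" "Im z"] that c1 ab
    by (auto simp: U_def F_def)
  have F2: "F z \<in> rel_interior t2" if "z \<in> U" "Im z < 0" for z
    using rel_interior_triangle_mem [OF c2(2), of "Re z" "- Im z"] that c2 ab
    by (auto simp: U_def F_def)
  have Fe: "F z \<in> rel_interior e" if "0 < Re z" "Re z < 1" "Im z = 0" for z
  proof -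
    have "F z = (1 - Re z) *\<^sub>R a + Re z *\<^sub>R b"
      using that by (simp add: F_def algebra_simps)
    then show ?thesis
      unfolding ab(3) in_segment using that ab(1) by blast
  qed
  then have F0: "F z \<in> rel_interior e" if "z \<in> U" "Im z = 0" for z
    using that by (simp add: U_def)
  have ne': "e \<noteq> t1" "e \<noteq> t2"
    using dime tdim by auto
  have dis: "rel_interior e \<inter> rel_interior t1 = {}" "rel_interior e \<inter> rel_interior t2 = {}"
    "rel_interior t1 \<inter> rel_interior t2 = {}"
    using rel_interior_inj eK tK ne ne' by blast+
  have injF: "inj_on F U"
  proof (rule inj_onI)
    fix z w assume zw: "z \<in> U" "w \<in> U" "F z = F w"
    consider "Im z \<ge> 0" "Im w \<ge> 0" | "Im z \<le> 0" "Im w \<le> 0" | "Im z > 0" "Im w < 0" | "Im z < 0" "Im w > 0"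
      by linarith
    then show "z = w"
    proof cases
      case 1
      have "(Re z - Re w) *\<^sub>R (b - a) + (Im z - Im w) *\<^sub>R (c1 - a) = F z - F w"
        using 1 by (simp add: F_def algebra_simps)
      then show ?thesis
        using affine_independent_3_coords [OF c1(2), of "Re z - Re w" "Im z - Im w"] zw(3) c1 ab
        by (simp add: complex_eq_iff)
    next
      case 2
      have "(Re z - Re w) *\<^sub>R (b - a) + (Im w - Im z) *\<^sub>R (c2 - a) = F z - F w"
        using 2 by (simp add: F_def algebra_simps)
      then show ?thesis
        using affine_independent_3_coords [OF c2(2), of "Re z - Re w" "Im w - Im z"] zw(3) c2 ab
        by (simp add: complex_eq_iff)
    next
      case 3
      then show ?thesis
        using F1 [of z] F2 [of w] zw dis by auto
    next
      case 4
      then show ?thesis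
        using F1 [of w] F2 [of z] zw dis by auto
    qed
  qed
  have FU: "F z \<in> rel_interior e \<union> rel_interior t1 \<union> rel_interior t2" if "z \<in> U" for z
    using F0 F1 F2 that by (metis UnCI linorder_neqE)
  have dom: "F z \<in> \<Union>K" "F z \<noteq> q" "F z \<noteq> x0" if "z \<in> U" for z
  proof -
    show "F z \<in> \<Union>K"
      using FU [OF that] eK tK rel_interior_subset by blast
    show "F z \<noteq> q"
      using FU [OF that] pinch_notin_rel_interior eK tK dime tdim by force
    show "F z \<noteq> x0"
      using that by (simp add: U_def)
  qed
  have "open ((\<psi> \<circ> F) ` U)"
  proof (rule invariance_of_domain [OF _ opU])
    show "continuous_on U (\<psi> \<circ> F)"
      using dom by (intro continuous_on_compose contF continuous_on_subset [OF continuous_on_psi]) auto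
    show "inj_on (\<psi> \<circ> F) U"
    proof (rule inj_onI)
      fix z w assume "z \<in> U" "w \<in> U" "(\<psi> \<circ> F) z = (\<psi> \<circ> F) w"
      then have "F z = F w"
        using g_psi dom by (metis comp_apply)
      then show "z = w"
        using injF \<open>z \<in> U\<close> \<open>w \<in> U\<close> by (meson inj_onD)
    qed
  qed
  moreover obtain z where z: "z \<in> U" "Im z = 0"
  proof -
    have "F (1/2) \<in> rel_interior e"
      by (rule Fe) auto
    then have "F (1/2) \<noteq> x0"
      using x0_notin_edge [OF e(1)] rel_interior_subset by blast
    then show ?thesis
      using that [of "1/2"] by (simp add: U_def)
  qed
  ultimately have "((\<psi> \<circ> F) ` U) \<inter> g -` rel_interior t3 \<noteq> {}"
  proof (intro rel_interior_face_dense [where z = "(\<psi> \<circ> F) z"])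
    show "g ((\<psi> \<circ> F) z) \<in> t3"
      using F0 [OF z] g_psi dom z e rel_interior_subset by fastforce
    show "(\<psi> \<circ> F) z \<notin> {\<alpha>, \<beta>}"
      using psi_nonpole dom z by simp
  qed (use z tK in auto)
  then obtain y where "y \<in> U" "F y \<in> rel_interior t3"
    using g_psi dom by auto
  moreover have "t3 \<noteq> e"
    using e by (auto simp: faces_def edges_def)
  ultimately show False
    using FU [of y] t3 rel_interior_inj tK eK by blast
qed

text \<open>Only the images of the ends are determined: if \<open>g u = q\<close>, the lifted edge
  may have the other pole as its end.\<close>

lemma edge_between:
  assumes "u \<in> lifted_verts" "v \<in> lifted_verts" "g u \<noteq> g v" "g u \<in> S" "g v \<in> S" "S \<in> K"
  obtains e where "e \<in> edges" "g ` edge_ends e = {g u, g v}" "e \<subseteq> S"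
proof -
  define e where "e = closed_segment (g u) (g v)"
  have "e \<in> K"
    unfolding e_def using edge_mem assms by (auto simp: lifted_verts_def verts_def)
  moreover have "1 simplex e"
    unfolding e_def using assms one_simplex_segment by blast
  ultimately have e: "e \<in> edges"
    using aff_dim_simplex by (auto simp: edges_def)
  have "g ` edge_ends e = {g u, g v}"
    using edge_eq_segment [OF e] by (simp add: e_def edge_ends_def closed_segment_eq)
  moreover have "e \<subseteq> S"
    unfolding e_def using assms closed_segment_subset complex_convex by blast
  ultimately show ?thesis
    using that e by blast
qed

section \<open>Connectedness of the lifted 1-skeleton\<close>

lemma pole_vert: "w \<in> {\<alpha>, \<beta>} \<Longrightarrow> w \<in> lifted_verts"
  using poles pinch_vertex by (auto simp: lifted_verts_def verts_def)

lemma edge_ends_neq: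
  assumes "e \<in> edges" "edge_ends e = {u, v}"
  shows "u \<noteq> v"
  using arc_distinct_ends [OF arc_edge_path [OF assms(1)]] assms(2)
  by (auto simp: edge_ends_def)

lemma in_face: obtains t where "t \<in> faces" "g z \<in> t"
proof -
  obtain S where "S \<in> K" "g z \<in> S"
    using g_mem by blast
  then show ?thesis
    using that purity by (metis empty_iff subsetD)
qed

text \<open>That \<open>q\<close> has edges does not settle that each pole has one. A point
  \<open>z\<close> near \<open>w\<close> lies in some triangle \<open>t\<close> at \<open>q\<close>;
  \<open>t\<close> approaches \<open>q\<close> through one pole, which must be \<open>w\<close>, and
  an edge of \<open>t\<close> from \<open>q\<close> approaches it the same way.\<close>

lemma pole_edge:
  assumes w: "w \<in> {\<alpha>, \<beta>}"
  obtains e v where "e \<in> edges" "v \<in> lifted_verts" "v \<notin> {\<alpha>, \<beta>}" "edge_ends e = {w, v}"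
proof -
  define F where "F = {t \<in> faces. q \<in> t}"
  have FK: "t \<in> K" if "t \<in> F" for t
    using that by (simp add: F_def faces_def)
  \<comment> \<open>For each triangle at \<open>q\<close>: the pole through which it approaches, and
    a radius within which it does so.\<close>
  have "\<forall>t. \<exists>r. t \<in> F \<longrightarrow> fst r \<in> {\<alpha>, \<beta>} \<and> 0 < snd r \<and> (t - {q}) \<inter> ball q (snd r) \<subseteq> g ` ball (fst r) \<eta>"
  proof
    fix t
    show "\<exists>r. t \<in> F \<longrightarrow> fst r \<in> {\<alpha>, \<beta>} \<and> 0 < snd r \<and> (t - {q}) \<inter> ball q (snd r) \<subseteq> g ` ball (fst r) \<eta>"
    proof (cases "t \<in> F")
      case True
      then have conv: "convex (t - {q})" and sub: "t - {q} \<subseteq> \<Union>K - {q}"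
        using FK convex_minus_vertex pinch_vertex by blast+
      obtain w' where w': "w' \<in> {\<alpha>, \<beta>}"
        and near: "\<And>\<epsilon>. 0 < \<epsilon> \<Longrightarrow> \<exists>d>0. (t - {q}) \<inter> ball q d \<subseteq> g ` ball w' \<epsilon>"
        by (rule convex_end [OF conv sub]) (rule that)
      from near [OF eta_pos] obtain d where "0 < d" "(t - {q}) \<inter> ball q d \<subseteq> g ` ball w' \<eta>"
        by blast
      then show ?thesis
        using w' by (intro exI [of _ "(w', d)"]) simp
    qed auto
  qed
  then obtain r where r: "\<forall>t. t \<in> F \<longrightarrow> fst (r t) \<in> {\<alpha>, \<beta>} \<and> 0 < snd (r t) \<and>
      (t - {q}) \<inter> ball q (snd (r t)) \<subseteq> g ` ball (fst (r t)) \<eta>"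
    by (rule choice [THEN exE])
  obtain d0 where d0: "0 < d0" "\<And>S. \<lbrakk>S \<in> K; S \<inter> ball q d0 \<noteq> {}\<rbrakk> \<Longrightarrow> q \<in> S"
    using near_point_simplices by blast
  have finF: "finite F"
    using finite_complex by (simp add: F_def faces_def)
  \<comment> \<open>A radius good for all triangles at once, fixed before \<open>z\<close>, because
    the triangle \<open>t\<close> is only found from \<open>z\<close>.\<close>
  define d where "d = Min (insert d0 ((\<lambda>t. snd (r t)) ` F))"
  have d: "0 < d" "d \<le> d0" "\<And>t. t \<in> F \<Longrightarrow> d \<le> snd (r t)"
    unfolding d_def using finF d0(1) r by auto
  obtain z where z: "z \<in> ball w \<eta>" "z \<notin> {\<alpha>, \<beta>}" "g z \<in> ball q d"
    using point_near_pole [OF d(1) eta_pos w] .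
  obtain t where t: "t \<in> faces" "g z \<in> t"
    using in_face .
  then have tK: "t \<in> K"
    by (simp add: faces_def)
  have "q \<in> t"
    by (rule d0(2) [OF tK]) (use t z(3) d(2) in auto)
  then have tF: "t \<in> F"
    using t by (simp add: F_def)
  have near: "y \<in> ball (fst (r t)) \<eta>" if y: "y \<notin> {\<alpha>, \<beta>}" "g y \<in> t" "g y \<in> ball q d" for y
  proof -
    have "g y \<in> (t - {q}) \<inter> ball q (snd (r t))"
      using y d(3) [OF tF] g_eq_q_iff [of y] by auto
    then obtain y' where "y' \<in> ball (fst (r t)) \<eta>" "g y = g y'"
      using r tF by blast
    then show ?thesis
      using y g_eqD by blast
  qed
  have same: "w1 = w2" if "w1 \<in> {\<alpha>, \<beta>}" "w2 \<in> {\<alpha>, \<beta>}" "y \<in> ball w1 \<eta>" "y \<in> ball w2 \<eta>" for w1 w2 y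
    using that pole_balls_disjointD by auto
  have rt: "fst (r t) = w"
    using same [of "fst (r t)" w z] near [of z] z t w r tF by blast
  have "g z \<noteq> q"
    using z g_eq_q_iff by blast
  then obtain a where a: "a \<in> t" "{a} \<in> K" "a \<noteq> q"
    using vertex_neq [OF tK t(2)] by blast
  have "a \<noteq> x0"
    using x0_mem_imp [OF a(2)] by auto
  then have ga: "g (\<psi> a) = a"
    using g_psi a tK by blast
  then have av: "\<psi> a \<in> lifted_verts" "\<psi> a \<notin> {\<alpha>, \<beta>}"
    using a poles by (auto simp: lifted_verts_def verts_def)
  obtain e where e: "e \<in> edges" "g ` edge_ends e = {g \<alpha>, g (\<psi> a)}" "e \<subseteq> t"
    by (rule edge_between [of \<alpha> "\<psi> a" t]) (use pole_vert av ga a tK \<open>q \<in> t\<close> poles in auto)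
  obtain s f where sf: "edge_ends e = {s, f}" "g s = q" "g f = a"
  proof -
    obtain s f where "edge_ends e = {s, f}"
      by (simp add: edge_ends_def)
    then show ?thesis
      using that [of s f] that [of f s] e(2) a poles ga by (auto simp: doubleton_eq_iff)
  qed
  have "f = \<psi> a"
    using g_eqD [of f "\<psi> a"] av(2) sf(3) ga by auto
  define G where "G = g -` rel_interior e"
  have im: "edge_image e = insert s (insert f G)"
    using edge_image_eq [OF e(1)] sf by (auto simp: G_def)
  have "connected (edge_image e)"
    unfolding edge_image_def using arc_edge_path [OF e(1)] by (simp add: connected_arc_image)
  moreover have "s \<noteq> f"
    using edge_ends_neq [OF e(1) sf(1)] .
  \<comment> \<open>A connected set with more than one point has no isolated points, so the open
    edge comes arbitrarily close to its end \<open>s\<close>. A point of it close enough to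
    \<open>s\<close> also lies in \<open>t\<close> near \<open>q\<close>, hence in the disc around
    \<open>w\<close>, which forces \<open>s = w\<close>.\<close>
  ultimately have "s islimpt edge_image e"
    using im by (intro connected_imp_perfect) auto
  then have "s islimpt G"
    by (simp add: im islimpt_insert)
  moreover have "s \<in> ball s \<eta> \<inter> g -` ball q d"
    using eta_pos sf d by simp
  moreover have "open (ball s \<eta> \<inter> g -` ball q d)"
    using cont by (simp add: open_Int open_vimage)
  ultimately obtain y where y: "y \<in> G" "y \<in> ball s \<eta>" "g y \<in> ball q d"
    unfolding islimpt_def by (metis Int_iff vimageD)
  have eK: "e \<in> K" "aff_dim e > 0"
    using e(1) by (auto simp: edges_def)
  have "g y \<noteq> q"
    using pinch_notin_rel_interior [OF eK] y by (auto simp: G_def)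
  then have "y \<in> ball (fst (r t)) \<eta>"
    using near [of y] y e(3) rel_interior_subset g_eq_q_iff by (auto simp: G_def)
  then have "s = w"
    using same [of s w y] rt w y g_eq_q_iff sf by auto
  then show ?thesis
    using that [OF e(1) av] sf \<open>f = \<psi> a\<close> by simp
qed

text \<open>Without an edge from \<open>S\<close> to \<open>B\<close>, the simplices with a vertex
  over \<open>S\<close> and those with a vertex over \<open>B\<close> would give two disjoint closed
  sets covering the plane without the poles, which is connected. So one of \<open>S\<close>,
  \<open>B\<close> contains poles only, and \<open>pole_edge\<close> supplies the missing
  edge.\<close>

lemma graph_connected:
  assumes S: "S \<subseteq> lifted_verts" "S \<noteq> {}" "S \<noteq> lifted_verts"
  shows "\<exists>e\<in>edges. \<exists>u\<in>S. \<exists>v\<in>lifted_verts - S. edge_ends e = {u, v}"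
proof (rule ccontr)
  assume neg: "\<not> ?thesis"
  define B where "B = lifted_verts - S"
  have nocross: False if "e \<in> edges" "edge_ends e = {u, v}" "u \<in> S" "v \<in> B" for e u v
    using neg that by (auto simp: B_def)
  \<comment> \<open>The poles are left out because \<open>g\<close> cannot tell them apart: having
    \<open>q\<close> as a vertex does not assign a simplex to \<open>S\<close> or to
    \<open>B\<close>.\<close>
  define X where "X = (\<lambda>A. \<Union>{\<sigma> \<in> K. \<exists>v\<in>A - {\<alpha>, \<beta>}. g v \<in> \<sigma>})"
  have clX: "closed (g -` X A)" for A
  proof -
    have "closed (X A)"
      unfolding X_def by (rule closed_Union_subcomplex) auto
    then show ?thesis
      using cont closed_vimage by blast
  qed
  have X_vert: "A \<subseteq> {\<alpha>, \<beta>}" if "A \<subseteq> lifted_verts" "g -` X A \<inter> - {\<alpha>, \<beta>} = {}" for A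
  proof
    fix v assume "v \<in> A"
    then have "v \<notin> {\<alpha>, \<beta>} \<Longrightarrow> g v \<in> X A"
      using that(1) by (auto simp: X_def lifted_verts_def verts_def)
    then show "v \<in> {\<alpha>, \<beta>}"
      using that(2) by blast
  qed
  have lift: "\<exists>v\<in>lifted_verts - {\<alpha>, \<beta>}. g v = a" if "{a} \<in> K" "a \<noteq> q" for a
  proof -
    have "a \<noteq> x0"
      using x0_mem_imp [OF that(1)] by auto
    then have "g (\<psi> a) = a" "\<psi> a \<notin> {\<alpha>, \<beta>}"
      using g_psi psi_nonpole that by blast+
    then show ?thesis
      using that by (auto simp: lifted_verts_def verts_def intro!: bexI [of _ "\<psi> a"])
  qed
  have adj: False if uv: "u \<in> S - {\<alpha>, \<beta>}" "v \<in> B - {\<alpha>, \<beta>}" "g u \<in> \<sigma>" "g v \<in> \<sigma>" "\<sigma> \<in> K" for u v \<sigma>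
  proof -
    have "g u \<noteq> g v"
      using uv g_eqD [of u v] by (auto simp: B_def)
    moreover have "u \<in> lifted_verts" "v \<in> lifted_verts"
      using uv S by (auto simp: B_def)
    ultimately obtain e where e: "e \<in> edges" "g ` edge_ends e = {g u, g v}"
      using edge_between [of u v \<sigma>] uv(3-5) by metis
    have "edge_ends e = {u, v}"
    proof
      show "edge_ends e \<subseteq> {u, v}"
      proof
        fix z assume "z \<in> edge_ends e"
        then have "g z = g u \<or> g z = g v"
          using e by auto
        then show "z \<in> {u, v}"
          using g_eqD uv by blast
      qed
      have "\<exists>z\<in>edge_ends e. g z = g y" if "y \<in> {u, v}" for y
        using e(2) that by (metis imageE insert_iff singletonD)
      then show "{u, v} \<subseteq> edge_ends e"
        using g_eqD uv by (metis DiffD2 subsetI insertE singletonD)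
    qed
    then show False
      using nocross e uv by blast
  qed
  have cover: "- {\<alpha>, \<beta>} \<subseteq> g -` X S \<union> g -` X B"
  proof
    fix z assume "z \<in> - {\<alpha>, \<beta>}"
    then have "g z \<noteq> q"
      using g_eq_q_iff by blast
    obtain \<sigma> where \<sigma>: "\<sigma> \<in> K" "g z \<in> \<sigma>"
      using g_mem by blast
    then obtain a where a: "a \<in> \<sigma>" "{a} \<in> K" "a \<noteq> q"
      using vertex_neq \<open>g z \<noteq> q\<close> by metis
    then obtain v where "v \<in> lifted_verts - {\<alpha>, \<beta>}" "g v = a"
      using lift by blast
    then show "z \<in> g -` X S \<union> g -` X B"
      using \<sigma> a by (auto simp: X_def B_def)
  qed
  have disj: "g -` X S \<inter> g -` X B \<inter> - {\<alpha>, \<beta>} = {}"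
  proof (rule ccontr)
    assume "\<not> ?thesis"
    then obtain z where z: "z \<notin> {\<alpha>, \<beta>}" "g z \<in> X S" "g z \<in> X B"
      by blast
    then obtain \<sigma> \<tau> u v where uv: "\<sigma> \<in> K" "u \<in> S - {\<alpha>, \<beta>}" "g u \<in> \<sigma>" "g z \<in> \<sigma>"
      "\<tau> \<in> K" "v \<in> B - {\<alpha>, \<beta>}" "g v \<in> \<tau>" "g z \<in> \<tau>"
      unfolding X_def by blast
    have "g z \<noteq> q"
      using z g_eq_q_iff by blast
    \<comment> \<open>The intersection is a simplex through a point other than \<open>q\<close>, so
      it has a vertex \<open>a\<close> other than \<open>q\<close>. Whichever class the lift of
      \<open>a\<close> belongs to, it shares \<open>\<sigma>\<close> or \<open>\<tau>\<close> with a
      vertex of the opposite class.\<close>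
    then obtain a where a: "a \<in> \<sigma> \<inter> \<tau>" "{a} \<in> K" "a \<noteq> q"
      using vertex_neq [OF complex_Int_mem [OF uv(1,5)], of "g z"] uv by blast
    then obtain y where y: "y \<in> lifted_verts - {\<alpha>, \<beta>}" "g y = a"
      using lift by blast
    show False
    proof (cases "y \<in> S")
      case True
      then show ?thesis
        using adj [of y v \<tau>] y a uv by blast
    next
      case False
      then show ?thesis
        using adj [of u y \<sigma>] y a uv by (auto simp: B_def)
    qed
  qed
  have "connected (- {\<alpha>, \<beta>})"
    by (intro path_connected_imp_connected path_connected_complement_countable) auto
  then have "g -` X S \<inter> - {\<alpha>, \<beta>} = {} \<or> g -` X B \<inter> - {\<alpha>, \<beta>} = {}"
    using clX cover disj unfolding connected_closed by blast
  then have "S \<subseteq> {\<alpha>, \<beta>} \<or> B \<subseteq> {\<alpha>, \<beta>}"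
    using X_vert [of S] X_vert [of B] S by (auto simp: B_def)
  then show False
  proof
    assume S2: "S \<subseteq> {\<alpha>, \<beta>}"
    then obtain w where w: "w \<in> S" "w \<in> {\<alpha>, \<beta>}"
      using S by blast
    obtain e v where "e \<in> edges" "v \<in> lifted_verts" "v \<notin> {\<alpha>, \<beta>}" "edge_ends e = {w, v}"
      using pole_edge [OF w(2)] .
    then show False
      using nocross [of e w v] w S2 by (auto simp: B_def)
  next
    assume B2: "B \<subseteq> {\<alpha>, \<beta>}"
    then obtain w where w: "w \<in> B" "w \<in> {\<alpha>, \<beta>}"
      using S unfolding B_def by blast
    obtain e v where "e \<in> edges" "v \<in> lifted_verts" "v \<notin> {\<alpha>, \<beta>}" "edge_ends e = {w, v}"
      using pole_edge [OF w(2)] .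
    then show False
      using nocross [of e v w] w B2 unfolding B_def by (metis DiffI insert_commute subsetD)
  qed
qed

section \<open>Spanning tree, dual tree and the count\<close>

definition "graph S D = S \<union> \<Union>(edge_image ` D)"

lemma spanning_tree:
  obtains D where "finite D" "D \<subseteq> edges" "card D = card verts"
    "path_connected (graph lifted_verts D)" "connected (- graph lifted_verts D)"
proof -
  \<comment> \<open>Compactness is part of the invariant because Janiszewski's theorem asks for
    it.\<close>
  define P where "P = (\<lambda>S D. compact (graph S D) \<and> path_connected (graph S D) \<and> connected (- graph S D))"
  obtain D where D: "finite D" "D \<subseteq> edges" "card D + 1 = card lifted_verts" "P lifted_verts D"
  proof (rule spanning_tree_induct [where P = P and N = edge_ends and X = lifted_verts and E = edges])
    show "finite lifted_verts"
      by (rule card_lifted_verts)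
    show "\<alpha> \<in> lifted_verts"
      by (simp add: pole_vert)
    show "P {\<alpha>} {}"
      unfolding P_def graph_def
      by (auto intro!: path_connected_imp_connected path_connected_complement_countable)
    show "\<exists>e\<in>edges. \<exists>u\<in>S. \<exists>v\<in>lifted_verts - S. edge_ends e = {u, v}"
      if "S \<subseteq> lifted_verts" "S \<noteq> {}" "S \<noteq> lifted_verts" for S
      using graph_connected that .
  next
    fix S D e u v
    assume PSD: "P S D" and S: "S \<subseteq> lifted_verts" and D: "D \<subseteq> edges"
      and ends: "\<And>d. d \<in> D \<Longrightarrow> edge_ends d \<subseteq> S" and e: "e \<in> edges - D" "edge_ends e = {u, v}"
      and u: "u \<in> S" and v: "v \<in> lifted_verts - S"
    have eq: "graph (insert v S) (insert e D) = graph S D \<union> edge_image e"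
      using edge_image_eq [of e] e by (auto simp: graph_def)
    have "edge_image e \<inter> edge_image d \<subseteq> {u}" if "d \<in> D" for d
    proof -
      have "edge_image e \<inter> edge_image d \<subseteq> edge_ends e \<inter> edge_ends d"
        by (rule edge_image_Int) (use e D that in auto)
      then show ?thesis
        using ends [OF that] e v by auto
    qed
    moreover have "edge_image e \<inter> S \<subseteq> {u}"
      using edge_image_Int_verts [of e] e S v by auto
    moreover have "u \<in> edge_image e"
      using edge_image_eq [of e] e by auto
    ultimately have int: "graph S D \<inter> edge_image e = {u}"
      using u by (auto simp: graph_def)
    have arc: "arc (edge_path e)"
      using e arc_edge_path by blast
    have "compact (edge_image e)" "path_connected (edge_image e)" "connected (- edge_image e)"
      unfolding edge_image_def
      using arc by (auto simp: compact_arc_image path_connected_path_image arc_imp_path connected_arc_complement)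
    then show "P (insert v S) (insert e D)"
      using PSD unfolding P_def eq
      by (intro conjI compact_Un path_connected_Un Janiszewski_connected) (auto simp: int compact_imp_closed)
  qed
  then have "card D = card verts"
    using card_lifted_verts by simp
  then show ?thesis
    using that D by (auto simp: P_def)
qed

lemma vimage_rel_interior_nonempty:
  assumes "S \<in> K" "aff_dim S > 0"
  shows "g -` rel_interior S \<noteq> {}"
proof
  assume emp: "g -` rel_interior S = {}"
  have "rel_interior S \<subseteq> {x0}"
  proof
    fix x assume x: "x \<in> rel_interior S"
    then have "x \<in> \<Union>K" "x \<notin> range g"
      using assms(1) rel_interior_subset emp by auto
    then show "x \<in> {x0}"
      unfolding range_g by blast
  qed
  then have "S \<subseteq> {x0}"
    using closure_mono [of "rel_interior S" "{x0}"] closure_rel_interior_complex [OF assms(1)] by simp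
  then have "aff_dim S \<le> 0"
    using aff_dim_subset [of S "{x0}"] by simp
  then show False
    using assms by simp
qed

lemma rel_interior_disjoint_edge_image:
  assumes "S \<in> K" "aff_dim S > 0" "e \<in> edges" "S \<noteq> e"
  shows "g -` rel_interior S \<inter> edge_image e = {}"
  using edge_image_eq [OF assms(3)] edge_ends_subset [OF assms(3)] rel_interior_lifted_verts [OF assms(1,2)]
    rel_interior_inj [OF assms(1), of e] assms by (auto simp: edges_def)

lemma rel_interior_disjoint_graph:
  assumes "S \<in> K" "aff_dim S > 0" "D \<subseteq> edges" "S \<notin> D"
  shows "g -` rel_interior S \<inter> graph lifted_verts D = {}"
proof -
  have "g -` rel_interior S \<inter> edge_image e = {}" if "e \<in> D" for e
    using rel_interior_disjoint_edge_image [OF assms(1,2), of e] assms that by blast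
  then show ?thesis
    using rel_interior_lifted_verts [OF assms(1,2)] by (auto simp: graph_def)
qed

lemma over_edge:
  assumes "e \<in> edges" "S \<in> K" "e \<subseteq> S"
  shows "S = e \<or> S \<in> faces"
proof (rule ccontr)
  assume neg: "\<not> ?thesis"
  have e: "e \<in> K" "aff_dim e = 1"
    using assms by (auto simp: edges_def)
  have "aff_dim S \<noteq> 2"
    using neg assms by (simp add: faces_def)
  then have "aff_dim S \<le> aff_dim e"
    using dim_le [OF assms(2)] e by simp
  moreover have "e face_of S"
    using complex_Int [OF assms(2) e(1)] assms(3) by (simp add: Int_absorb1)
  ultimately show False
    using face_of_aff_dim_lt [of S e] complex_convex [OF assms(2)] neg by auto
qed

text \<open>Otherwise the complement of the graph would split. Attach to each class of triangles the
  edges outside \<open>D\<close> that lie in one of them. Both families are closed under passing to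
  larger simplices, so their relative interiors fill open sets; these are disjoint, as no such edge
  serves both classes, and every point off the graph is in one of them.\<close>

lemma dual_crossing:
  assumes D: "D \<subseteq> edges" "connected (- graph lifted_verts D)"
    and A: "A \<subseteq> faces" "A \<noteq> {}" "A \<noteq> faces"
  shows "\<exists>e\<in>edges - D. \<exists>t\<in>A. \<exists>t'\<in>faces - A. {t \<in> faces. e \<subseteq> t} = {t, t'}"
proof (rule ccontr)
  assume neg: "\<not> ?thesis"
  \<comment> \<open>By \<open>edge_in_two_faces\<close>, an edge shared by the two classes has
    exactly these two triangles, which is the form excluded by \<open>neg\<close>.\<close>
  have nocross: False if e: "e \<in> edges - D" "t \<in> A" "t' \<in> faces - A" "e \<subseteq> t" "e \<subseteq> t'" for e t t'
  proof -
    have "{s \<in> faces. e \<subseteq> s} = {t, t'}"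
      using edge_in_two_faces [of e t t'] e A by auto
    then show False
      using neg e by blast
  qed
  define Q where "Q = (\<lambda>C. C \<union> {e \<in> edges - D. \<exists>t\<in>C. e \<subseteq> t})"
  define W where "W = (\<lambda>C. \<Union>(rel_interior ` Q C))"
  have QK: "Q C \<subseteq> K" if "C \<subseteq> faces" for C
    using that by (auto simp: Q_def faces_def edges_def)
  have Qup: "S' \<in> Q C" if C: "C = A \<or> C = faces - A" and SQ: "S \<in> Q C" and S': "S' \<in> K" "S \<subseteq> S'" for C S S'
  proof (cases "S \<in> C")
    case True
    then have S: "S \<in> K" "aff_dim S = 2"
      using that A by (auto simp: faces_def)
    have "S face_of S'"
      using complex_Int [OF S'(1) S(1)] S'(2) by (simp add: Int_absorb1)
    then have "S' = S"
      using face_of_aff_dim_lt [of S' S] complex_convex [OF S'(1)] dim_le [OF S'(1)] S by auto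
    then show ?thesis
      using that by simp
  next
    case False
    then obtain t where t: "S \<in> edges - D" "t \<in> C" "S \<subseteq> t"
      using SQ by (auto simp: Q_def)
    have "S' = S \<or> S' \<in> faces"
      using over_edge [of S S'] t that by blast
    then show ?thesis
    proof
      assume "S' \<in> faces"
      then have "S' \<in> C"
        using nocross [OF t(1)] t that A by blast
      then show ?thesis
        by (simp add: Q_def)
    qed (use that in simp)
  qed
  have openW: "open (g -` W C)" if C: "C = A \<or> C = faces - A" for C
  proof -
    \<comment> \<open>Upward closure turns \<open>W C\<close> into a union of open stars.\<close>
    have "W C = (\<Union>S\<in>Q C. \<Union>S'\<in>{S' \<in> K. S \<subseteq> S'}. rel_interior S')"
    proof
      show "W C \<subseteq> (\<Union>S\<in>Q C. \<Union>S'\<in>{S' \<in> K. S \<subseteq> S'}. rel_interior S')"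
        using QK [of C] C A by (force simp: W_def)
      show "(\<Union>S\<in>Q C. \<Union>S'\<in>{S' \<in> K. S \<subseteq> S'}. rel_interior S') \<subseteq> W C"
        using Qup [OF C] by (auto simp: W_def)
    qed
    moreover have "openin (top_of_set (\<Union>K)) (\<Union>S\<in>Q C. \<Union>S'\<in>{S' \<in> K. S \<subseteq> S'}. rel_interior S')"
      using QK [of C] C A openin_open_star by (intro openin_Union) blast
    ultimately show ?thesis
      using open_vimage_openin by simp
  qed
  have "Q A \<inter> Q (faces - A) = {}"
    using nocross A by (auto simp: Q_def edges_def faces_def)
  then have disj: "W A \<inter> W (faces - A) = {}"
    using rel_interior_inj QK [of A] QK [of "faces - A"] A unfolding W_def by blast
  have cover: "- graph lifted_verts D \<subseteq> g -` W A \<union> g -` W (faces - A)"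
  proof
    fix z assume z: "z \<in> - graph lifted_verts D"
    obtain S where S: "S \<in> K" "g z \<in> rel_interior S"
      using carrier_simplex g_mem by blast
    then have "g z \<in> S"
      using rel_interior_subset by blast
    have "aff_dim S \<noteq> 0"
    proof
      assume "aff_dim S = 0"
      then have "S = {g z}"
        using \<open>g z \<in> S\<close> by (metis aff_dim_eq_0 singletonD)
      then have "z \<in> lifted_verts"
        using S by (simp add: lifted_verts_def verts_def)
      then show False
        using z by (simp add: graph_def)
    qed
    moreover have "aff_dim S \<noteq> -1"
      using \<open>g z \<in> S\<close> aff_dim_empty [of S] by auto
    ultimately have "aff_dim S = 1 \<or> aff_dim S = 2"
      using dim_le [OF S(1)] aff_dim_geq [of S] by linarith
    then have "S \<in> Q A \<union> Q (faces - A)"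
    proof
      assume "aff_dim S = 2"
      then show ?thesis
        using S by (auto simp: Q_def faces_def)
    next
      assume "aff_dim S = 1"
      then have e: "S \<in> edges"
        using S by (simp add: edges_def)
      then have "S \<notin> D"
        using z S edge_image_eq [OF e] by (auto simp: graph_def)
      moreover obtain t where "t \<in> faces" "S \<subseteq> t"
        using purity [OF S(1)] \<open>g z \<in> S\<close> by blast
      ultimately show ?thesis
        using e by (auto simp: Q_def)
    qed
    then show "z \<in> g -` W A \<union> g -` W (faces - A)"
      using S by (auto simp: W_def)
  qed
  have meets: "g -` W C \<inter> - graph lifted_verts D \<noteq> {}" if C: "C \<subseteq> faces" "C \<noteq> {}" for C
  proof -
    obtain t where t: "t \<in> C" "t \<in> K" "aff_dim t = 2"
      using C by (auto simp: faces_def)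
    then have "t \<notin> D"
      using D by (auto simp: edges_def)
    then have "g -` rel_interior t \<inter> graph lifted_verts D = {}"
      using rel_interior_disjoint_graph [of t D] t D by auto
    moreover have "g -` rel_interior t \<noteq> {}"
      using vimage_rel_interior_nonempty [of t] t by simp
    moreover have "g -` rel_interior t \<subseteq> g -` W C"
      using t by (auto simp: W_def Q_def)
    ultimately show ?thesis
      by blast
  qed
  have "g -` W A \<inter> g -` W (faces - A) \<inter> - graph lifted_verts D = {}"
    using disj by blast
  from connectedD [OF D(2) openW openW this cover] meets [of A] meets [of "faces - A"] A
  show False
    by blast
qed

text \<open>Only \<open>t0\<close> loses a point to the puncture, and a convex set of dimension 2
  stays connected without it.\<close>

lemma connected_face:
  assumes "t \<in> faces"
  shows "connected (g -` rel_interior t)"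
proof -
  have t: "t \<in> K" "aff_dim t = 2"
    using assms by (auto simp: faces_def)
  have q: "q \<notin> rel_interior t"
    using pinch_notin_rel_interior t by simp
  have sub: "rel_interior t - {x0} \<subseteq> \<Union>K - {q, x0}"
    using q t rel_interior_subset by blast
  have "g -` rel_interior t = \<psi> ` (rel_interior t - {x0})" (is "?l = ?r")
  proof (intro equalityI subsetI)
    fix z assume z: "z \<in> ?l"
    then have "z = \<psi> (g z)"
      using psi_g q g_eq_q_iff by (metis vimageE)
    then show "z \<in> ?r"
      using z g_mem by blast
  next
    fix z assume "z \<in> ?r"
    then obtain x where x: "x \<in> rel_interior t - {x0}" "z = \<psi> x"
      by blast
    then have "g z = x"
      using g_psi sub by blast
    then show "z \<in> ?l"
      using x by simp
  qed
  moreover have "connected (rel_interior t - {x0})"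
    using t complex_convex by (intro connected_punctured_convex) (auto simp: convex_rel_interior rel_interior_aff_dim)
  ultimately show ?thesis
    using connected_continuous_image [OF continuous_on_subset [OF continuous_on_psi sub]] by simp
qed

text \<open>The open edge lies in the closure of the open triangle. This is what passes the side of
  a Jordan curve from a triangle to its neighbour.\<close>

lemma connected_face_edge:
  assumes "t \<in> faces" "e \<in> edges" "e \<subseteq> t"
  shows "connected (g -` rel_interior t \<union> g -` rel_interior e)"
proof (rule connected_intermediate_closure [OF connected_face [OF assms(1)]])
  have e: "e \<in> K" "aff_dim e > 0"
    using assms(2) by (auto simp: edges_def)
  have tK: "t \<in> K"
    using assms(1) by (simp add: faces_def)
  have "g -` rel_interior e \<subseteq> closure (g -` rel_interior t)"
  proof
    fix z assume z: "z \<in> g -` rel_interior e"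
    then have "z \<notin> {\<alpha>, \<beta>}" "g z \<in> t"
      using pinch_notin_rel_interior [OF e] g_eq_q_iff [of z] rel_interior_subset assms by auto
    then have "\<forall>Y. open Y \<and> z \<in> Y \<longrightarrow> Y \<inter> g -` rel_interior t \<noteq> {}"
      using rel_interior_face_dense tK by blast
    then show "z \<in> closure (g -` rel_interior t)"
      by (meson closure_iff_nhds_not_empty order_refl Int_commute disjoint_iff subsetD)
  qed
  then show "g -` rel_interior t \<union> g -` rel_interior e \<subseteq> closure (g -` rel_interior t)"
    using closure_subset by blast
qed auto

lemma euler_characteristic: "card verts + card faces = card edges + 1"
proof -
  obtain T where T: "finite T" "T \<subseteq> edges" "card T = card verts"
    "path_connected (graph lifted_verts T)" "connected (- graph lifted_verts T)"
    using spanning_tree .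
  define N where "N = (\<lambda>e. {t \<in> faces. e \<subseteq> t})"
  \<comment> \<open>Connectedness of the dual graph in terms of 2-colourings: one that agrees across
    every edge of \<open>D\<close> is constant on \<open>A\<close>. The colour used below is the
    side of a Jordan curve.\<close>
  define P where "P = (\<lambda>A D. \<forall>c :: 'a set \<Rightarrow> bool. (\<forall>e\<in>D. \<forall>t\<in>N e. \<forall>t'\<in>N e. c t = c t')
      \<longrightarrow> (\<forall>t\<in>A. \<forall>t'\<in>A. c t = c t'))"
  have finf: "finite faces"
    using finite_complex by (simp add: faces_def)
  have t0f: "t0 \<in> faces"
    using t0 by (simp add: faces_def)
  obtain D where D: "finite D" "D \<subseteq> edges - T" "card D + 1 = card faces" "P faces D"
  proof (rule spanning_tree_induct [where P = P and N = N and X = faces and E = "edges - T", OF finf t0f])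
    show "\<exists>e\<in>edges - T. \<exists>t\<in>A. \<exists>t'\<in>faces - A. N e = {t, t'}"
      if "A \<subseteq> faces" "A \<noteq> {}" "A \<noteq> faces" for A
      unfolding N_def using dual_crossing [OF T(2,5) that] .
    show "P {t0} {}"
      by (simp add: P_def)
  next
    fix A D e u v
    assume "P A D" "N e = {u, v}" "u \<in> A"
    then show "P (insert v A) (insert e D)"
      unfolding P_def by (smt (verit) insert_iff)
  qed
  have "e \<in> T \<union> D" if e: "e \<in> edges" for e
  proof (rule ccontr)
    assume "e \<notin> T \<union> D"
    define G where "G = graph lifted_verts T"
    have ends: "edge_ends e \<subseteq> G"
      using edge_ends_subset [OF e] by (auto simp: G_def graph_def)
    define p where "p = edge_path e"
    have p: "arc p" "path_image p = edge_image e" "edge_ends e = {pathstart p, pathfinish p}"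
      using arc_edge_path [OF e] by (auto simp: p_def edge_image_def edge_ends_def)
    \<comment> \<open>The return arc runs inside the tree, so the closed curve misses all open
      triangles and all open edges other than \<open>e\<close> and those of \<open>T\<close>, in
      particular those of \<open>D\<close>.\<close>
    obtain p' where p': "arc p'" "path_image p' \<subseteq> G" "pathstart p' = pathfinish p" "pathfinish p' = pathstart p"
      using T(4) ends p arc_distinct_ends [OF p(1)] unfolding G_def path_connected_arcwise
      by (metis insert_subset)
    have "g -` rel_interior e \<inter> G = {}"
      unfolding G_def
      by (rule rel_interior_disjoint_graph) (use e T \<open>e \<notin> T \<union> D\<close> in \<open>auto simp: edges_def\<close>)
    then have "path_image p \<inter> path_image p' \<subseteq> {pathstart p, pathstart p'}"
      using p' p edge_image_eq [OF e] by auto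
    then have simple: "simple_path (p +++ p')"
      using p p' by (intro simple_path_join_loop) auto
    have loop: "pathfinish (p +++ p') = pathstart (p +++ p')"
      using p' by simp
    define J where "J = path_image (p +++ p')"
    have J: "J \<subseteq> edge_image e \<union> G"
      unfolding J_def using p p' by (auto simp: path_image_join)
    define I where "I = inside J"
    define U where "U = outside J"
    have IU: "I \<noteq> {}" "open I" "U \<noteq> {}" "open U" "I \<inter> U = {}" "I \<union> U = - J"
      using Jordan_inside_outside [OF simple loop] by (auto simp: I_def U_def J_def)
    have side: "C \<subseteq> I \<or> C \<subseteq> U" if "connected C" "C \<inter> J = {}" for C
    proof -
      have "C \<subseteq> I \<union> U" "I \<inter> U \<inter> C = {}"
        using that IU by auto
      then have "I \<inter> C = {} \<or> U \<inter> C = {}"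
        using connectedD [OF that(1) IU(2,4)] by blast
      then show ?thesis
        using \<open>C \<subseteq> I \<union> U\<close> by blast
    qed
    have J_disj: "g -` rel_interior S \<inter> J = {}" if "S \<in> K" "aff_dim S > 0" "S \<notin> T" "S \<noteq> e" for S
      using rel_interior_disjoint_graph [OF that(1,2) T(2) that(3)]
        rel_interior_disjoint_edge_image [OF that(1,2) e that(4)] J by (auto simp: G_def)
    have face_J: "g -` rel_interior t \<inter> J = {}" "g -` rel_interior t \<noteq> {}" if "t \<in> faces" for t
    proof -
      have t: "t \<in> K" "aff_dim t = 2"
        using that by (auto simp: faces_def)
      have "t \<notin> T" "t \<noteq> e"
        using t T(2) e by (auto simp: edges_def)
      with t show "g -` rel_interior t \<inter> J = {}" "g -` rel_interior t \<noteq> {}"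
        using J_disj [of t] vimage_rel_interior_nonempty [of t] by auto
    qed
    define c where "c = (\<lambda>t. g -` rel_interior t \<subseteq> I)"
    \<comment> \<open>All triangles at \<open>d\<close> lie on the same side as the open edge
      \<open>d\<close>, which \<open>J\<close> does not meet.\<close>
    have cI: "c t \<longleftrightarrow> g -` rel_interior d \<subseteq> I" if "d \<in> D" "t \<in> N d" for d t
    proof -
      have d: "d \<in> edges" "d \<notin> T" "d \<noteq> e" "d \<in> K" "aff_dim d > 0"
        using that D \<open>e \<notin> T \<union> D\<close> by (auto simp: edges_def)
      have t: "t \<in> faces" "d \<subseteq> t"
        using that by (auto simp: N_def)
      have "g -` rel_interior d \<inter> J = {}" "g -` rel_interior d \<noteq> {}"
        using J_disj [of d] vimage_rel_interior_nonempty [of d] d by auto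
      moreover have "g -` rel_interior t \<union> g -` rel_interior d \<subseteq> I
          \<or> g -` rel_interior t \<union> g -` rel_interior d \<subseteq> U"
        by (rule side [OF connected_face_edge [OF t(1) d(1) t(2)]]) (use calculation face_J t in blast)
      ultimately show ?thesis
        using face_J [OF t(1)] IU(5) unfolding c_def by blast
    qed
    have "\<forall>d\<in>D. \<forall>t\<in>N d. \<forall>t'\<in>N d. c t = c t'"
      using cI by blast
    then have const: "\<forall>t\<in>faces. \<forall>t'\<in>faces. c t = c t'"
      using D(4) unfolding P_def by blast
    obtain t where t: "t \<in> faces" "I \<inter> g -` rel_interior t \<noteq> {}"
      using faces_dense [OF IU(2,1)] .
    then have "c t"
      using side [OF connected_face [OF t(1)] face_J(1) [OF t(1)]] IU(5) unfolding c_def by blast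
    obtain t' where t': "t' \<in> faces" "U \<inter> g -` rel_interior t' \<noteq> {}"
      using faces_dense [OF IU(4,3)] .
    then have "\<not> c t'"
      using IU(5) unfolding c_def by blast
    then show False
      using const t t' \<open>c t\<close> by blast
  qed
  then have "edges = T \<union> D"
    using T D by blast
  then have "card edges = card T + card D"
    using T D by (metis card_Un_disjoint Diff_disjoint disjoint_iff subsetD)
  then show ?thesis
    using T D by simp
qed

end

section \<open>The pinched torus as a quotient of the sphere\<close>

text \<open>\<open>x0\<close> is chosen inside a triangle and different from the pinch, so it has a
  single preimage \<open>y0\<close>; the sphere without \<open>y0\<close> is a plane, which yields
  the chart.\<close>

lemma euler_characteristic_pinched_sphere:
  fixes K :: "'a::euclidean_space set set" and \<rho> :: "complex \<times> real \<Rightarrow> 'a"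
  assumes K: "simplicial_complex K" "two_dimensional K"
    and cont: "continuous_on (sphere 0 1) \<rho>" and im: "\<rho> ` sphere 0 1 = \<Union>K"
    and poles: "n \<in> sphere 0 1" "s \<in> sphere 0 1" "n \<noteq> s" "\<rho> n = \<rho> s"
    and inj: "\<And>y z. \<lbrakk>y \<in> sphere 0 1; z \<in> sphere 0 1; \<rho> y = \<rho> z\<rbrakk> \<Longrightarrow> y = z \<or> y \<in> {n, s} \<and> z \<in> {n, s}"
  shows "card {v. {v} \<in> K} + card {S \<in> K. aff_dim S = 2} = card {S \<in> K. aff_dim S = 1} + 1"
proof -
  interpret simplicial_cpx K
    by unfold_locales (rule K)
  obtain t0 where t0: "t0 \<in> K" "aff_dim t0 = 2" and dim: "\<And>S. S \<in> K \<Longrightarrow> aff_dim S \<le> 2"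
    using K by (auto simp: two_dimensional_def)
  have "aff_dim (rel_interior t0) = 2"
    using t0 complex_convex by (simp add: rel_interior_aff_dim)
  then have "\<not> rel_interior t0 \<subseteq> {\<rho> n}"
    using aff_dim_subset [of "rel_interior t0" "{\<rho> n}"] by auto
  then obtain x0 where x0: "x0 \<in> rel_interior t0" "x0 \<noteq> \<rho> n"
    by blast
  then have "x0 \<in> \<Union>K"
    using t0 rel_interior_subset by blast
  then obtain y0 where y0: "y0 \<in> sphere 0 1" "\<rho> y0 = x0"
    using im by (metis imageE)
  have y0_ne: "n \<noteq> y0" "s \<noteq> y0"
    using x0 y0 poles by auto
  have "sphere (0 :: complex \<times> real) 1 - {y0} homeomorphic (UNIV :: complex set)"
    by (rule homeomorphic_punctured_sphere_affine) (use y0 in auto)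
  then obtain \<tau> \<sigma> where hom: "homeomorphism (sphere 0 1 - {y0}) (UNIV :: complex set) \<tau> \<sigma>"
    by (auto simp: homeomorphic_def)
  have \<sigma>\<tau>: "\<sigma> (\<tau> y) = y" if "y \<in> sphere 0 1" "y \<noteq> y0" for y
    using hom that by (auto simp: homeomorphism_def)
  have cont\<sigma>: "continuous_on UNIV \<sigma>"
    using hom by (auto simp: homeomorphism_def)
  have range\<sigma>: "range \<sigma> = sphere 0 1 - {y0}" and \<tau>\<sigma>: "\<And>z. \<tau> (\<sigma> z) = z"
    using hom by (auto simp: homeomorphism_def)
  then have \<sigma>_mem: "\<sigma> z \<in> sphere 0 1" "\<sigma> z \<noteq> y0" for z
    by blast+
  have uniq: "y = y0" if "y \<in> sphere 0 1" "\<rho> y = x0" for y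
    using inj [OF that(1) y0(1)] that y0 y0_ne by auto
  interpret pinched_cpx K "\<rho> \<circ> \<sigma>" "\<tau> n" "\<tau> s" "\<rho> n" x0 t0
  proof unfold_locales
    show "aff_dim S \<le> 2" if "S \<in> K" for S
      using dim that .
    show "continuous_on UNIV (\<rho> \<circ> \<sigma>)"
      using cont\<sigma> cont \<sigma>_mem by (intro continuous_on_compose continuous_on_subset [OF cont]) auto
    show "\<tau> n \<noteq> \<tau> s"
      using \<sigma>\<tau> poles y0_ne by metis
    show "(\<rho> \<circ> \<sigma>) (\<tau> n) = \<rho> n" "(\<rho> \<circ> \<sigma>) (\<tau> s) = \<rho> n"
      using \<sigma>\<tau> poles y0_ne by auto
    show "z = w \<or> z \<in> {\<tau> n, \<tau> s} \<and> w \<in> {\<tau> n, \<tau> s}" if "(\<rho> \<circ> \<sigma>) z = (\<rho> \<circ> \<sigma>) w" for z w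
    proof -
      have "\<sigma> z = \<sigma> w \<or> \<sigma> z \<in> {n, s} \<and> \<sigma> w \<in> {n, s}"
        using inj [OF \<sigma>_mem(1) \<sigma>_mem(1), of z w] that by simp
      then show ?thesis
        using \<tau>\<sigma> [of z] \<tau>\<sigma> [of w] by auto
    qed
    show "range (\<rho> \<circ> \<sigma>) = \<Union>K - {x0}"
    proof -
      have "range (\<rho> \<circ> \<sigma>) = \<rho> ` (sphere 0 1 - {y0})"
        by (metis image_comp range\<sigma>)
      also have "\<dots> = \<rho> ` sphere 0 1 - {x0}"
      proof (intro equalityI subsetI)
        fix x assume "x \<in> \<rho> ` (sphere 0 1 - {y0})"
        then obtain y where y: "x = \<rho> y" "y \<in> sphere 0 1" "y \<noteq> y0"
          by blast
        then have "x \<noteq> x0"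
          using uniq by blast
        then show "x \<in> \<rho> ` sphere 0 1 - {x0}"
          using y by blast
      qed (use y0(2) in blast)
      finally show ?thesis
        using im by simp
    qed
    show "openin (top_of_set (\<Union>K)) ((\<rho> \<circ> \<sigma>) ` Y)" if Y: "open Y" "\<tau> n \<in> Y \<longleftrightarrow> \<tau> s \<in> Y" for Y
    proof -
      \<comment> \<open>On the compact sphere \<open>\<rho>\<close> is a closed map. Since
        \<open>Z\<close> is open and contains both or neither of \<open>n\<close> and
        \<open>s\<close>, its image is the complement of the closed image of the rest of the
        sphere.\<close>
      define Z where "Z = \<sigma> ` Y"
      have "openin (top_of_set (sphere 0 1 - {y0})) Z"
        unfolding Z_def
        by (rule homeomorphism_imp_open_map [OF homeomorphism_symD [OF hom]]) (use Y in auto)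
      moreover have "openin (top_of_set (sphere 0 1)) (sphere 0 1 - {y0})"
        by (simp add: openin_delete)
      ultimately have opZ: "openin (top_of_set (sphere 0 1)) Z"
        using openin_trans by blast
      then have "closedin (top_of_set (sphere 0 1)) (sphere 0 1 - Z)"
        using closedin_diff closedin_topspace by (metis topspace_euclidean_subtopology closedin_def openin_closedin_eq)
      then have "compact (sphere 0 1 - Z)"
        using closedin_compact compact_sphere by blast
      then have "compact (\<rho> ` (sphere 0 1 - Z))"
        by (intro compact_continuous_image continuous_on_subset [OF cont]) auto
      then have cl: "closed (\<rho> ` (sphere 0 1 - Z))"
        by (rule compact_imp_closed)
      have ZN: "n \<in> Z \<longleftrightarrow> s \<in> Z"
      proof -
        have "y \<in> Z \<longleftrightarrow> \<tau> y \<in> Y" if "y \<in> sphere 0 1" "y \<noteq> y0" for y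
          unfolding Z_def using \<sigma>\<tau> [OF that] \<tau>\<sigma> by force
        then show ?thesis
          using Y poles y0_ne by auto
      qed
      have Zs: "Z \<subseteq> sphere 0 1"
        using \<sigma>_mem by (auto simp: Z_def)
      have "\<rho> ` Z \<inter> \<rho> ` (sphere 0 1 - Z) = {}"
      proof (rule ccontr)
        assume "\<not> ?thesis"
        then obtain y z where yz: "y \<in> Z" "z \<in> sphere 0 1 - Z" "\<rho> y = \<rho> z"
          by blast
        then have "y = z \<or> y \<in> {n, s} \<and> z \<in> {n, s}"
          using Zs by (intro inj) auto
        then show False
          using yz ZN by auto
      qed
      moreover have "\<Union>K = \<rho> ` Z \<union> \<rho> ` (sphere 0 1 - Z)"
        unfolding im [symmetric] using Zs by blast
      ultimately have "\<rho> ` Z = \<Union>K \<inter> - \<rho> ` (sphere 0 1 - Z)"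
        by blast
      then show ?thesis
        using cl by (metis Z_def image_comp open_Compl openin_open_Int)
    qed
  qed (use t0 x0 in auto)
  show ?thesis
    using euler_characteristic by (simp add: verts_def faces_def edges_def)
qed

text \<open>In terms of the parameterization, \<open>w = cos (u / 2) * cis v\<close> and
  \<open>s\<close> is \<open>sin (u / 2)\<close> up to sign. Then \<open>1 - 2 * s^2\<close> is
  \<open>cos u\<close>, and the sign of \<open>s\<close> is such that
  \<open>- 2 * s * cmod w\<close> is \<open>sin u\<close>. No angle occurs, so continuity is plain,
  and the circles shrink to a point at \<open>w = 0\<close>, that is at \<open>s = 1\<close> and
  \<open>s = - 1\<close>, both with \<open>u = pi\<close>.\<close>

definition pinch :: "real \<Rightarrow> real \<Rightarrow> complex \<times> real \<Rightarrow> real ^ 3" where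
  "pinch r1 r2 = (\<lambda>(w, s). vector [(r1 + r2 * Re w) * (1 - 2 * s\<^sup>2),
      - 2 * (r1 + r2 * Re w) * s * cmod w, r2 * Im w])"

lemma mem_unit_sphere: "(w, s) \<in> sphere (0 :: complex \<times> real) 1 \<longleftrightarrow> (cmod w)\<^sup>2 + s\<^sup>2 = 1"
  by (simp add: norm_Pair)

lemma vector_3_eq_iff: "(vector [a, b, c] :: real ^ 3) = vector [a', b', c'] \<longleftrightarrow> a = a' \<and> b = b' \<and> c = c'"
  by (simp add: vec_eq_iff forall_3)

lemma continuous_on_pinch: "continuous_on A (pinch r1 r2)"
proof -
  have "vector [a, b, c] = a *\<^sub>R axis 1 1 + b *\<^sub>R axis 2 1 + c *\<^sub>R (axis 3 1 :: real ^ 3)" for a b c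
    by (simp add: vec_eq_iff forall_3 axis_def)
  then show ?thesis
    unfolding pinch_def case_prod_unfold by (simp only:) (intro continuous_intros)
qed

text \<open>The squares of the first two coordinates add up to \<open>(r1 + r2 * Re w)^2\<close>,
  and this radius is positive because \<open>Re w \<ge> - 1\<close> and \<open>r2 < r1\<close>. So
  the image gives back \<open>Re w\<close>, then \<open>Im w\<close>, and finally \<open>s\<close>
  unless \<open>w = 0\<close>.\<close>

lemma pinch_eqD:
  assumes r: "0 < r2" "r2 < r1"
    and y: "(w, s) \<in> sphere 0 1" "(w', s') \<in> sphere 0 1"
    and eq: "pinch r1 r2 (w, s) = pinch r1 r2 (w', s')"
  shows "(w, s) = (w', s') \<or> w = 0 \<and> w' = 0"
proof -
  have sq: "(r1 + r2 * Re w)\<^sup>2 = ((r1 + r2 * Re w) * (1 - 2 * s\<^sup>2))\<^sup>2 + (- 2 * (r1 + r2 * Re w) * s * cmod w)\<^sup>2"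
    if "(w, s) \<in> sphere 0 1" for w s
  proof -
    have m: "(cmod w)\<^sup>2 = 1 - s\<^sup>2"
      using that unfolding mem_unit_sphere by simp
    have "(R * (1 - 2 * s\<^sup>2))\<^sup>2 + (- 2 * R * s * cmod w)\<^sup>2
      = R\<^sup>2 * ((1 - 2 * s\<^sup>2)\<^sup>2 + 4 * s\<^sup>2 * (cmod w)\<^sup>2)" for R
      by (simp add: power_mult_distrib distrib_left)
    moreover have "(1 - 2 * s\<^sup>2)\<^sup>2 + 4 * s\<^sup>2 * (cmod w)\<^sup>2 = 1"
      unfolding m by (simp add: power2_eq_square algebra_simps)
    ultimately show ?thesis
      by (metis mult.right_neutral)
  qed
  have pos: "0 < r1 + r2 * Re w" if "(w, s) \<in> sphere 0 1" for w and s :: real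
  proof -
    have "(cmod w)\<^sup>2 \<le> 1"
      using that zero_le_power2 [of s] unfolding mem_unit_sphere by linarith
    then have "cmod w \<le> 1"
      by (simp add: abs_square_le_1)
    then have "- 1 \<le> Re w"
      using abs_Re_le_cmod [of w] by linarith
    then have "r2 * (- 1) \<le> r2 * Re w"
      using r by (intro mult_left_mono) auto
    then show ?thesis
      using r by linarith
  qed
  have comps: "(r1 + r2 * Re w) * (1 - 2 * s\<^sup>2) = (r1 + r2 * Re w') * (1 - 2 * s'\<^sup>2)"
    "- 2 * (r1 + r2 * Re w) * s * cmod w = - 2 * (r1 + r2 * Re w') * s' * cmod w'"
    "r2 * Im w = r2 * Im w'"
    using eq by (auto simp: pinch_def vector_3_eq_iff)
  then have "(r1 + r2 * Re w)\<^sup>2 = (r1 + r2 * Re w')\<^sup>2"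
    using sq [OF y(1)] sq [OF y(2)] by simp
  then have R: "r1 + r2 * Re w = r1 + r2 * Re w'"
    using pos [OF y(1)] pos [OF y(2)] by (simp add: power2_eq_iff)
  then have "w = w'"
    using comps r by (simp add: complex_eq_iff)
  moreover have "s = s'" if "w \<noteq> 0"
    using comps(2) pos [OF y(1)] that unfolding \<open>w = w'\<close> by simp
  ultimately show ?thesis
    by auto
qed

lemma pinch_image: "pinch r1 r2 ` sphere 0 1 = pinched_torus r1 r2"
proof (intro equalityI subsetI)
  fix x assume "x \<in> pinch r1 r2 ` sphere 0 1"
  then obtain w s where ws: "(w, s) \<in> sphere (0 :: complex \<times> real) 1" "x = pinch r1 r2 (w, s)"
    by (metis imageE surj_pair)
  then have m: "(cmod w)\<^sup>2 + s\<^sup>2 = 1"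
    unfolding mem_unit_sphere by simp
  \<comment> \<open>A sign for \<open>cos (u / 2)\<close> with the wanted \<open>u = 2 * a\<close>:
    points with \<open>s \<le> 0\<close> get \<open>u \<le> pi\<close>, the others
    \<open>u \<ge> pi\<close>.\<close>
  define \<epsilon> :: real where "\<epsilon> = (if s \<le> 0 then 1 else - 1)"
  have \<epsilon>: "\<epsilon>\<^sup>2 = 1" "\<epsilon> * \<epsilon> = 1" and s: "\<bar>s\<bar> = - \<epsilon> * s"
    by (auto simp: \<epsilon>_def)
  have "(\<epsilon> * cmod w)\<^sup>2 + \<bar>s\<bar>\<^sup>2 = 1"
    using m \<epsilon> by (simp add: power_mult_distrib)
  then obtain a where a: "0 \<le> a" "a \<le> pi" "\<epsilon> * cmod w = cos a" "\<bar>s\<bar> = sin a"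
    using sincos_total_pi [of "\<bar>s\<bar>" "\<epsilon> * cmod w"] by auto
  \<comment> \<open>The angle is that of \<open>\<epsilon> * w\<close> and not of \<open>w\<close>,
    as a negative \<open>cos (u / 2)\<close> turns the circle by half a revolution.\<close>
  define v where "v = Arg2pi (of_real \<epsilon> * w)"
  have v: "0 \<le> v" "v \<le> 2 * pi"
    using Arg2pi [of "of_real \<epsilon> * w"] by (auto simp: v_def)
  have "of_real \<epsilon> * w = of_real (cmod w) * cis v"
    using Arg2pi_eq [of "of_real \<epsilon> * w"] \<epsilon> by (simp add: v_def norm_mult \<epsilon>_def cis_conv_exp split: if_splits)
  then have "Re (of_real \<epsilon> * w) = cmod w * cos v" "Im (of_real \<epsilon> * w) = cmod w * sin v"
    by simp_all
  then have w: "\<epsilon> * Re w = cmod w * cos v" "\<epsilon> * Im w = cmod w * sin v"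
    by simp_all
  have "Re w = (\<epsilon> * \<epsilon>) * Re w" "Im w = (\<epsilon> * \<epsilon>) * Im w"
    by (simp_all add: \<epsilon>)
  then have w': "Re w = cos v * cos a" "Im w = sin v * cos a"
    using w a(3) by (simp_all add: mult_ac flip: a(3))
  have cos2: "1 - 2 * s\<^sup>2 = cos (2 * a)"
    using a(4) by (metis cos_double_sin power2_abs)
  have "- 2 * s * cmod w = 2 * (- \<epsilon> * s) * (\<epsilon> * cmod w)"
    using \<epsilon>(2) by (simp add: algebra_simps)
  also have "\<dots> = sin (2 * a)"
    by (simp only: s [symmetric] a sin_double)
  finally have sin2: "- 2 * s * cmod w = sin (2 * a)" .
  have "x = vector [(r1 + r2 * cos v * cos (2 * a / 2)) * cos (2 * a),
      (r1 + r2 * cos v * cos (2 * a / 2)) * sin (2 * a), r2 * sin v * cos (2 * a / 2)]"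
    unfolding ws(2) pinch_def prod.case vector_3_eq_iff cos2 [symmetric] sin2 [symmetric]
    by (simp add: w' algebra_simps)
  then show "x \<in> pinched_torus r1 r2"
    unfolding pinched_torus_def using a v by (intro CollectI exI [of _ "2 * a"] exI [of _ v]) auto
next
  fix x assume "x \<in> pinched_torus r1 r2"
  then obtain u v where u: "u \<in> {0..2 * pi}"
    and x: "x = vector [(r1 + r2 * cos v * cos (u / 2)) * cos u,
              (r1 + r2 * cos v * cos (u / 2)) * sin u, r2 * sin v * cos (u / 2)]"
    by (auto simp: pinched_torus_def)
  define w where "w = of_real (cos (u / 2)) * cis v"
  \<comment> \<open>The two halves of the range of \<open>u\<close> go to the two hemispheres; this
    makes up for the sign lost in \<open>cmod w\<close>, which is only the absolute value of
    \<open>cos (u / 2)\<close>.\<close>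
  define s where "s = (if cos (u / 2) \<ge> 0 then - sin (u / 2) else sin (u / 2))"
  have cw: "cmod w = \<bar>cos (u / 2)\<bar>"
    by (simp add: w_def norm_mult)
  have s2: "s\<^sup>2 = (sin (u / 2))\<^sup>2"
    by (simp add: s_def)
  have mem: "(w, s) \<in> sphere 0 1"
    unfolding mem_unit_sphere by (simp add: cw s2)
  have cos2: "1 - 2 * s\<^sup>2 = cos u"
    unfolding s2 using cos_double_sin [of "u / 2"] by simp
  have sin2: "- 2 * s * cmod w = sin u"
    using sin_double [of "u / 2"] by (simp add: cw s_def)
  have "Re w = cos v * cos (u / 2)" "Im w = sin v * cos (u / 2)"
    by (simp_all add: w_def)
  then have "x = pinch r1 r2 (w, s)"
    unfolding x pinch_def prod.case vector_3_eq_iff cos2 [symmetric] sin2 [symmetric]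
    by (simp add: algebra_simps)
  then show "x \<in> pinch r1 r2 ` sphere 0 1"
    using mem by blast
qed

theorem mainTheorem6:
  fixes r1 r2 :: real
    and T :: "'a::euclidean_space set set"
    and h :: "'a \<Rightarrow> real ^ 3"
  assumes "0 < r2" and "r2 < r1"
    and "surface_triangulation T h (pinched_torus r1 r2)"
  shows "int (num_simplices 0 T) - int (num_simplices 1 T) + int (num_simplices 2 T) = 1"
proof -
  obtain k where T: "simplicial_complex T" "two_dimensional T"
    and hom: "homeomorphism (\<Union>T) (pinched_torus r1 r2) h k"
    using assms by (auto simp: surface_triangulation_def)
  interpret simplicial_cpx T
    by unfold_locales (rule T)
  define \<rho> where "\<rho> = k \<circ> pinch r1 r2"
  have "card {v. {v} \<in> T} + card {S \<in> T. aff_dim S = 2} = card {S \<in> T. aff_dim S = 1} + 1"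
  proof (rule euler_characteristic_pinched_sphere [OF T, of \<rho> "(0, 1)" "(0, - 1)"])
    have "continuous_on (pinched_torus r1 r2) k"
      using hom by (simp add: homeomorphism_def)
    then show "continuous_on (sphere 0 1) \<rho>"
      unfolding \<rho>_def by (intro continuous_on_compose continuous_on_pinch) (simp add: pinch_image)
    show "\<rho> ` sphere 0 1 = \<Union>T"
      using homeomorphism_image2 [OF hom] unfolding \<rho>_def by (metis image_comp pinch_image)
    show "(0, 1) \<in> sphere (0 :: complex \<times> real) 1" "(0, - 1) \<in> sphere (0 :: complex \<times> real) 1"
      unfolding mem_unit_sphere by simp_all
    show "\<rho> (0, 1) = \<rho> (0, - 1)"
      by (simp add: \<rho>_def pinch_def)
    fix y z :: "complex \<times> real"
    assume yz: "y \<in> sphere 0 1" "z \<in> sphere 0 1" "\<rho> y = \<rho> z"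
    obtain w s w' s' where ws: "y = (w, s)" "z = (w', s')"
      by fastforce
    have "pinch r1 r2 y \<in> pinched_torus r1 r2" "pinch r1 r2 z \<in> pinched_torus r1 r2"
      using yz pinch_image by blast+
    then have "pinch r1 r2 y = pinch r1 r2 z"
      using yz(3) hom by (metis \<rho>_def comp_apply homeomorphism_apply2)
    then have "y = z \<or> w = 0 \<and> w' = 0"
      using pinch_eqD [OF assms(1,2)] yz ws by metis
    \<comment> \<open>On the sphere, \<open>w = 0\<close> leaves only \<open>s = 1\<close> and
      \<open>s = - 1\<close>.\<close>
    then show "y = z \<or> y \<in> {(0, 1), (0, - 1)} \<and> z \<in> {(0, 1), (0, - 1)}"
      using yz(1,2) unfolding ws mem_unit_sphere by (auto simp: power2_eq_1_iff)
  qed auto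
  moreover have "num_simplices 0 T = card {v. {v} \<in> T}"
  proof -
    have "{S \<in> T. 0 simplex S} = (\<lambda>v. {v}) ` {v. {v} \<in> T}"
      by (auto simp: simplex_zero)
    then show ?thesis
      unfolding num_simplices_def by (simp add: card_image)
  qed
  moreover have "num_simplices n T = card {S \<in> T. aff_dim S = n}" for n
    unfolding num_simplices_def using complex_simplex_iff by (metis (mono_tags, lifting) Collect_cong)
  ultimately show ?thesis
    by simp
qed

end
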